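(* Let $\{Y(x,t),x\in\mathbb{R}^d,t\in\mathbb{R}\}$ be a real-valued measurable centered Gaussian random field which is positively associated (PA) or negatively associated (NA), with covariance function $\mathrm{Cov}(Y(x,t),Y(y,s))=C(x,y)\tilde C(|t-s|)$, $x,y\in\mathbb{R}^d$, $s,t\in\mathbb{R}$, and $\mathbf{E}[Y^2(x,t)]=1$. Assume that $\tilde C$ is non-negative and $\tilde C(r)\to0$ as $r\to+\infty$. Let $W_n=U_n\times(a_n,b_n)$ be a sequence of Borel sets such that $r_n:=b_n-a_n\to+\infty$ as $n\to\infty$, $0<c_1\le\nu_d(U_n)\le c_2<+\infty$ for constants $c_1,c_2$, and $$\tilde\kappa=\lim_{n\to\infty}\int_{U_n}\int_{U_n}C(x,y)\,\nu_d(dx)\,\nu_d(dy)\in(0,+\infty).$$ Let $f:\mathbb{R}\to\mathbb{R}$ be Borel-measurable, $X(x,t)=f(Y(x,t))$, and let $u\in\mathbb{R}$ be such that $\langle H_1,\mathbf{1}\{f(\cdot)\ge u\}\rangle_\varphi\ne0$. If for some $\delta\in(0,1)$ $$\frac{1}{r^\delta}\int_0^r\tilde C(v)\,dv\to\infty,\quad r\to\infty,$$ then $$\frac{\int_{a_n}^{b_n}\int_{U_n}\mathbf{1}\{X(x,t)\ge u\}\,\nu_d(dx)\,dt-\nu_d(U_n)(b_n-a_n)\,\mathbb{P}(X(0)\ge u)}{\langle H_1,\mathbf{1}\{f(\cdot)\ge u\}\rangle_\varphi\sqrt{2\tilde\kappa\int_0^{r_n}\tilde C(s)(r_n-s)\,ds}}\xrightarrow{d}N(0,1)$$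 as $n\to\infty$, where $0\in\mathbb{R}^{d+1}$.
   Context: $\nu_d$ is Lebesgue measure on $\mathbb{R}^d$; $\varphi(x)=\frac{1}{\sqrt{2\pi}}e^{-x^2/2}$; $\langle G_1,G_2\rangle_\varphi=\int_{\mathbb{R}}G_1(x)G_2(x)\varphi(x)\,dx$; $H_1(x)=x$. A Gaussian random field is PA (respectively NA) if its covariance function is non-negative (respectively non-positive). $\xrightarrow{d}$ denotes convergence in distribution. *)

theory Defs
  imports "HOL-Probability.Probability"
begin

definition cov :: "'w measure \<Rightarrow> ('w \<Rightarrow> real) \<Rightarrow> ('w \<Rightarrow> real) \<Rightarrow> real" where
  "cov M X Y = (LINT \<omega>|M. (X \<omega> - (LINT \<omega>'|M. X \<omega>')) * (Y \<omega> - (LINT \<omega>'|M. Y \<omega>')))"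

(* The second disjunct is the degenerate normal law, of variance 0, which
   normal_density does not cover. *)
definition gaussian_rv :: "'w measure \<Rightarrow> ('w \<Rightarrow> real) \<Rightarrow> bool" where
  "gaussian_rv M X \<longleftrightarrow> X \<in> borel_measurable M \<and>
     ((\<exists>\<mu> \<sigma>. \<sigma> > 0 \<and> distributed M lborel X (normal_density \<mu> \<sigma>)) \<or>
      (\<exists>\<mu>. AE \<omega> in M. X \<omega> = \<mu>))"

(* Joint normality of the finite-dimensional distributions, expressed by the
   normality of all finite linear combinations. *)
definition gaussian_field :: "'w measure \<Rightarrow> ('i \<Rightarrow> 'w \<Rightarrow> real) \<Rightarrow> bool" where
  "gaussian_field M Y \<longleftrightarrow> prob_space M \<and>
     (\<forall>I c. finite I \<longrightarrow> gaussian_rv M (\<lambda>\<omega>. \<Sum>i\<in>I. c i * Y i \<omega>))"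

definition centered_field :: "'w measure \<Rightarrow> ('i \<Rightarrow> 'w \<Rightarrow> real) \<Rightarrow> bool" where
  "centered_field M Y \<longleftrightarrow> (\<forall>i. integrable M (Y i) \<and> (LINT \<omega>|M. Y i \<omega>) = 0)"

(* Joint measurability in the index and the sample point. *)
definition measurable_field ::
    "'w measure \<Rightarrow> ('i::topological_space \<Rightarrow> 'w \<Rightarrow> real) \<Rightarrow> bool" where
  "measurable_field M Y \<longleftrightarrow> (\<lambda>(i, \<omega>). Y i \<omega>) \<in> borel_measurable (borel \<Otimes>\<^sub>M M)"

(* Positive and negative association, for Gaussian fields, in terms of the sign
   of the covariance function.  For negative association the diagonal is
   excluded: there the covariance is a variance, hence never negative. *)
definition gaussian_PA :: "'w measure \<Rightarrow> ('i \<Rightarrow> 'w \<Rightarrow> real) \<Rightarrow> bool" where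
  "gaussian_PA M Y \<longleftrightarrow> gaussian_field M Y \<and> (\<forall>i j. cov M (Y i) (Y j) \<ge> 0)"

definition gaussian_NA :: "'w measure \<Rightarrow> ('i \<Rightarrow> 'w \<Rightarrow> real) \<Rightarrow> bool" where
  "gaussian_NA M Y \<longleftrightarrow> gaussian_field M Y \<and> (\<forall>i j. i \<noteq> j \<longrightarrow> cov M (Y i) (Y j) \<le> 0)"

definition inner_phi :: "(real \<Rightarrow> real) \<Rightarrow> (real \<Rightarrow> real) \<Rightarrow> real" where
  "inner_phi G\<^sub>1 G\<^sub>2 = (LINT x|lborel. G\<^sub>1 x * G\<^sub>2 x * std_normal_density x)"

(* The first Hermite polynomial. *)
definition H\<^sub>1 :: "real \<Rightarrow> real" where
  "H\<^sub>1 x = x"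

end

theory Submission
  imports Defs
begin

text \<open>
  Put \<open>g y = 1\<close> if \<open>f y \<ge> u\<close> and \<open>g y = 0\<close> otherwise, and decompose \<open>g y = c0 + c1 y + R y\<close>, where \<open>c0\<close>
  and \<open>c1\<close> are the first two Hermite coefficients of \<open>g\<close>; then \<open>R\<close> is orthogonal to \<open>1\<close> and \<open>y\<close> under
  the standard normal law. The centered volume of the excursion set is \<open>c1\<close> times the integral of
  \<open>Y\<close> over the window, plus the integral of \<open>R Y\<close>.

  The integral of \<open>Y\<close> is Gaussian (\<open>char_average\<close>). Its variance is the double integral of the
  covariance, that is the spatial factor times \<open>2 * J r\<close>, where \<open>J r\<close> is the integral of
  \<open>Ct s * (r - s)\<close> over \<open>{0..r}\<close> (\<open>double_average_cylinder\<close>, \<open>integral_interval_difference\<close>). The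
  normalisation divides by \<open>c1\<close> times the square root of this variance, with the spatial factor
  replaced by its limit.

  The integral of \<open>R Y\<close> is negligible. Two jointly Gaussian standard normal variables with
  correlation \<open>\<rho>\<close> satisfy \<open>\<bar>E (R X * R Z)\<bar> \<le> 2 \<rho>\<^sup>2 E ((R X)\<^sup>2)\<close> (\<open>rank_two_covariance_bound\<close>), so that
  the variance of this integral is at most a constant times the integral of \<open>(Ct s)\<^sup>2 * (r - s)\<close>. Since \<open>Ct\<close> tends to \<open>0\<close> while its integral
  diverges, this is of smaller order than \<open>J r\<close> (\<open>weighted_square_negligible\<close>). Convergence of the
  characteristic functions and Levy's continuity theorem conclude the proof.

  Two points need care. First, joint normality means normality of finite linear combinations, so
  the law of a pair of values is obtained by Kac's theorem (\<open>pair_law_eqI\<close>); the covariance bound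
  then comes from one explicit Gaussian integral, that of the squared joint density
  (\<open>integral_mehler_kernel_square\<close>). Second, the field is only measurable, so its integral is not a
  limit of Riemann sums; it is approximated in mean square by finite linear combinations at points
  chosen greedily (\<open>linear_combination_near_average\<close>).
\<close>

section \<open>Square-integrable functions\<close>

lemma integrable_mult_square:
  fixes f g :: "'a \<Rightarrow> real"
  assumes [measurable]: "f \<in> borel_measurable M" "g \<in> borel_measurable M"
    and "integrable M (\<lambda>x. (f x)\<^sup>2)" "integrable M (\<lambda>x. (g x)\<^sup>2)"
  shows "integrable M (\<lambda>x. f x * g x)"
proof (rule Bochner_Integration.integrable_bound)
  show "integrable M (\<lambda>x. (f x)\<^sup>2 + (g x)\<^sup>2)"
    using assms by simp
  have "\<bar>s * t\<bar> \<le> s\<^sup>2 + t\<^sup>2" for s t :: real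
    using sum_squares_bound[of "\<bar>s\<bar>" "\<bar>t\<bar>"] mult_nonneg_nonneg[of "\<bar>s\<bar>" "\<bar>t\<bar>"]
    unfolding abs_mult power2_abs by linarith
  then show "AE x in M. norm (f x * g x) \<le> norm ((f x)\<^sup>2 + (g x)\<^sup>2)"
    by (intro AE_I2) simp
qed simp

lemma integrable_diff_square:
  fixes f g :: "'a \<Rightarrow> real"
  assumes "f \<in> borel_measurable M" "g \<in> borel_measurable M"
    and "integrable M (\<lambda>x. (f x)\<^sup>2)" "integrable M (\<lambda>x. (g x)\<^sup>2)"
  shows "integrable M (\<lambda>x. (f x - g x)\<^sup>2)"
  using assms integrable_mult_square[OF assms]
  by (auto simp: power2_diff mult.assoc)

lemma Cauchy_Schwarz_integral:
  fixes f g :: "'a \<Rightarrow> real"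
  assumes [measurable]: "f \<in> borel_measurable M" "g \<in> borel_measurable M"
    and f: "integrable M (\<lambda>x. (f x)\<^sup>2)" and g: "integrable M (\<lambda>x. (g x)\<^sup>2)"
  shows "(LINT x|M. f x * g x)\<^sup>2 \<le> (LINT x|M. (f x)\<^sup>2) * (LINT x|M. (g x)\<^sup>2)"
proof -
  define A B D where "A = (LINT x|M. (f x)\<^sup>2)" "B = (LINT x|M. f x * g x)"
    "D = (LINT x|M. (g x)\<^sup>2)"
  note fg = integrable_mult_square[OF assms]
  \<comment> \<open>Nonnegativity of the integral of \<open>(s f + t g)\<^sup>2\<close>, used below at \<open>(D, - B)\<close> if \<open>D > 0\<close>.\<close>
  have quadratic: "0 \<le> A * s\<^sup>2 + 2 * s * t * B + D * t\<^sup>2" for s t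
  proof -
    have "0 \<le> (LINT x|M. (s * f x + t * g x)\<^sup>2)"
      by simp
    also have "(\<lambda>x. (s * f x + t * g x)\<^sup>2) = (\<lambda>x. s\<^sup>2 * (f x)\<^sup>2 + (2 * s * t) * (f x * g x) + t\<^sup>2 * (g x)\<^sup>2)"
      by (auto simp: power2_eq_square algebra_simps)
    also have "(LINT x|M. s\<^sup>2 * (f x)\<^sup>2 + (2 * s * t) * (f x * g x) + t\<^sup>2 * (g x)\<^sup>2) =
        A * s\<^sup>2 + 2 * s * t * B + D * t\<^sup>2"
      using f g fg by (simp add: A_B_D_def)
    finally show ?thesis .
  qed
  have "D \<ge> 0" by (simp add: A_B_D_def)
  have "B\<^sup>2 \<le> A * D"
  proof (cases "D = 0")
    case True
    have "B = 0"
    proof (rule ccontr)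
      assume "B \<noteq> 0"
      then show False
        using quadratic[of 1 "- (A + 1) / (2 * B)"] True by (simp add: field_simps)
    qed
    then show ?thesis using True by simp
  next
    case False
    then have "D > 0" using \<open>D \<ge> 0\<close> by simp
    have "0 \<le> D * (A * D - B\<^sup>2)"
      using quadratic[of D "- B"] by (simp add: power2_eq_square algebra_simps)
    then show ?thesis
      using \<open>D > 0\<close> by (simp add: zero_le_mult_iff)
  qed
  then show ?thesis by (simp add: A_B_D_def)
qed

section \<open>Characteristic functions of Gaussian variables\<close>

lemma char_distr:
  assumes [measurable]: "X \<in> borel_measurable M"
  shows "char (distr M borel X) s = (CLINT \<omega>|M. iexp (s * X \<omega>))"
  by (simp add: char_def integral_distr)

lemma norm_iexp_diff_le: "cmod (iexp x - iexp y) \<le> \<bar>x - y\<bar>"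
proof -
  have "iexp x - iexp y = iexp y * (iexp (x - y) - 1)"
    by (simp add: exp_add[symmetric] algebra_simps)
  then have "cmod (iexp x - iexp y) = cmod (iexp (x - y) - 1)"
    by (simp add: norm_mult)
  then show ?thesis
    using iexp_approx1[of "x - y" 0] by simp
qed

lemma (in prob_space) norm_char_diff_le:
  assumes [measurable]: "X \<in> borel_measurable M" "Z \<in> borel_measurable M"
    and sq: "integrable M (\<lambda>\<omega>. (X \<omega> - Z \<omega>)\<^sup>2)"
  shows "cmod (char (distr M borel X) s - char (distr M borel Z) s)
    \<le> \<bar>s\<bar> * sqrt (expectation (\<lambda>\<omega>. (X \<omega> - Z \<omega>)\<^sup>2))"
proof -
  have int: "integrable M (\<lambda>\<omega>. X \<omega> - Z \<omega>)"
    by (rule square_integrable_imp_integrable[OF _ sq]) simp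
  have I: "integrable M (\<lambda>\<omega>. iexp (s * X \<omega>))" if "X \<in> borel_measurable M" for X
    using that by (intro integrable_iexp) auto
  have "cmod (char (distr M borel X) s - char (distr M borel Z) s)
      = cmod (CLINT \<omega>|M. iexp (s * X \<omega>) - iexp (s * Z \<omega>))"
    using Bochner_Integration.integral_diff[OF I[OF assms(1)] I[OF assms(2)]]
    by (simp only: char_distr[OF assms(1)] char_distr[OF assms(2)])
  also have "\<dots> \<le> expectation (\<lambda>\<omega>. cmod (iexp (s * X \<omega>) - iexp (s * Z \<omega>)))"
    by simp
  also have "\<dots> \<le> expectation (\<lambda>\<omega>. \<bar>s\<bar> * \<bar>X \<omega> - Z \<omega>\<bar>)"
  proof (rule integral_mono)
    show "integrable M (\<lambda>\<omega>. cmod (iexp (s * X \<omega>) - iexp (s * Z \<omega>)))"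
      using I by (intro integrable_norm Bochner_Integration.integrable_diff) auto
    show "integrable M (\<lambda>\<omega>. \<bar>s\<bar> * \<bar>X \<omega> - Z \<omega>\<bar>)"
      using int by simp
    show "cmod (iexp (s * X \<omega>) - iexp (s * Z \<omega>)) \<le> \<bar>s\<bar> * \<bar>X \<omega> - Z \<omega>\<bar>" for \<omega>
      using norm_iexp_diff_le[of "s * X \<omega>" "s * Z \<omega>"]
      by (simp add: abs_mult[symmetric] algebra_simps)
  qed
  also have "\<dots> = \<bar>s\<bar> * expectation (\<lambda>\<omega>. \<bar>X \<omega> - Z \<omega>\<bar>)"
    by simp
  also have "expectation (\<lambda>\<omega>. \<bar>X \<omega> - Z \<omega>\<bar>) \<le> sqrt (expectation (\<lambda>\<omega>. (X \<omega> - Z \<omega>)\<^sup>2))"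
    using Cauchy_Schwarz_integral[of "\<lambda>\<omega>. \<bar>X \<omega> - Z \<omega>\<bar>" M "\<lambda>_. 1"] sq
    by (intro real_le_rsqrt) (simp add: prob_space)
  finally show ?thesis
    by (simp add: mult_left_mono)
qed

lemma (in prob_space) centered_gaussian_rv:
  assumes X: "gaussian_rv M X" and mean: "expectation X = 0"
  shows integrable_square_gaussian_rv: "integrable M (\<lambda>\<omega>. (X \<omega>)\<^sup>2)"
    and char_gaussian_rv: "char (distr M borel X) s = exp (- (s\<^sup>2 * expectation (\<lambda>\<omega>. (X \<omega>)\<^sup>2)) / 2)"
proof -
  have [measurable]: "X \<in> borel_measurable M"
    using X by (simp add: gaussian_rv_def)
  have "integrable M (\<lambda>\<omega>. (X \<omega>)\<^sup>2) \<and>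
    char (distr M borel X) s = exp (- (s\<^sup>2 * expectation (\<lambda>\<omega>. (X \<omega>)\<^sup>2)) / 2)"
    using X unfolding gaussian_rv_def
  proof (elim conjE disjE exE)
    fix \<mu> \<sigma> :: real
    assume \<sigma>: "\<sigma> > 0" and D: "distributed M lborel X (normal_density \<mu> \<sigma>)"
    have \<mu>: "\<mu> = 0"
      using normal_distributed_expectation[OF \<sigma> D] mean by simp
    have sq: "integrable M (\<lambda>\<omega>. (X \<omega>)\<^sup>2)"
      using distributed_integrable[OF D, of "\<lambda>x. x\<^sup>2"] integrable_normal_moment[OF \<sigma>, of \<mu> 2]
      by (simp add: \<mu>)
    have var: "expectation (\<lambda>\<omega>. (X \<omega>)\<^sup>2) = \<sigma>\<^sup>2"
      using normal_distributed_variance[OF \<sigma> D] mean by simp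
    have std: "distributed M lborel (\<lambda>\<omega>. X \<omega> / \<sigma>) std_normal_density"
      using normal_standard_normal_convert[OF \<sigma>, of X \<mu>] D \<mu> by simp
    have "char (distr M borel X) s = char (distr M borel (\<lambda>\<omega>. X \<omega> / \<sigma>)) (s * \<sigma>)"
      using \<sigma> by (simp add: char_distr)
    also have "distr M borel (\<lambda>\<omega>. X \<omega> / \<sigma>) = std_normal_distribution"
      using distributed_distr_eq_density[OF std] by (simp cong: distr_cong)
    finally show ?thesis
      using sq var by (simp add: char_std_normal_distribution power_mult_distrib)
  next
    fix \<mu> assume "AE \<omega> in M. X \<omega> = \<mu>"
    moreover from this have "expectation X = \<mu>"
      using integral_cong_AE[of X M "\<lambda>_. \<mu>"] by (simp add: prob_space)
    ultimately have 0: "AE \<omega> in M. X \<omega> = 0" using mean by simp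
    then have "AE \<omega> in M. (X \<omega>)\<^sup>2 = 0" "AE \<omega> in M. iexp (s * X \<omega>) = 1" by auto
    then have "integrable M (\<lambda>\<omega>. (X \<omega>)\<^sup>2)" "expectation (\<lambda>\<omega>. (X \<omega>)\<^sup>2) = 0"
      "(CLINT \<omega>|M. iexp (s * X \<omega>)) = 1"
      using integrable_cong_AE[of "\<lambda>\<omega>. (X \<omega>)\<^sup>2" M "\<lambda>_. 0"] integral_cong_AE[of "\<lambda>\<omega>. (X \<omega>)\<^sup>2" M "\<lambda>_. 0"]
        integral_cong_AE[of "\<lambda>\<omega>. iexp (s * X \<omega>)" M "\<lambda>_. 1"] by (auto simp: prob_space)
    then show ?thesis by (simp add: char_distr)
  qed
  then show "integrable M (\<lambda>\<omega>. (X \<omega>)\<^sup>2)"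
    "char (distr M borel X) s = exp (- (s\<^sup>2 * expectation (\<lambda>\<omega>. (X \<omega>)\<^sup>2)) / 2)"
    by auto
qed

section \<open>Independence from a factorising characteristic function\<close>

lemma integral_indicator_comp:
  "(LINT \<omega>|M. indicator A (X \<omega>) :: real) = measure M (X -` A \<inter> space M)"
proof -
  have "(LINT \<omega>|M. indicator A (X \<omega>) :: real) = (LINT \<omega>|M. indicator (X -` A \<inter> space M) \<omega>)"
    by (intro Bochner_Integration.integral_cong) (auto simp: indicator_def)
  then show ?thesis by simp
qed

text \<open>
  A bounded weight \<open>w\<close> that acts on the characteristic function of \<open>X\<close> like the constant \<open>c\<close> acts
  like \<open>c\<close> on every event in \<open>X\<close>. The weight may change sign, but \<open>2 + w\<close> lies between \<open>1\<close> and \<open>3\<close>,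
  so that \<open>(2 + w) / (2 + c)\<close> is the density of a probability measure; under it \<open>X\<close> keeps its
  characteristic function, hence its law.
\<close>

lemma (in prob_space) weighted_law_eqI:
  fixes w X :: "'a \<Rightarrow> real"
  assumes [measurable]: "w \<in> borel_measurable M" "X \<in> borel_measurable M"
    and w: "\<And>\<omega>. \<bar>w \<omega>\<bar> \<le> 1"
    and eq: "\<And>s. (CLINT \<omega>|M. w \<omega> * iexp (s * X \<omega>)) = c * (CLINT \<omega>|M. iexp (s * X \<omega>))"
    and A[measurable]: "A \<in> sets borel"
  shows "expectation (\<lambda>\<omega>. w \<omega> * indicator A (X \<omega>)) = c * prob (X -` A \<inter> space M)"
proof -
  have int_w: "integrable M w"
    using w by (intro integrable_const_bound[of _ 1]) auto
  have "expectation w = c"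
  proof -
    have "complex_of_real (expectation w) = complex_of_real c"
      using eq[of 0] by (simp add: prob_space integral_complex_of_real)
    then show ?thesis by (simp only: of_real_eq_iff)
  qed
  have c: "2 + c > 0"
  proof -
    have "\<bar>expectation w\<bar> \<le> expectation (\<lambda>_. 1)"
      using w int_w by (intro integral_abs_bound[THEN order_trans] integral_mono) auto
    then show ?thesis using \<open>expectation w = c\<close> by (simp add: prob_space)
  qed
  define d where "d \<omega> = (2 + w \<omega>) / (2 + c)" for \<omega>
  have [measurable]: "d \<in> borel_measurable M"
    by (simp add: d_def[abs_def])
  have w': "- 1 \<le> w \<omega>" "w \<omega> \<le> 1" for \<omega>
    using w[of \<omega>] by auto
  have d0: "0 \<le> d \<omega>" for \<omega>
    using w'(1)[of \<omega>] c by (simp add: d_def)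
  have int_d: "integrable M d"
    using int_w by (simp add: d_def[abs_def])
  have d1: "expectation d = 1"
    using int_w c \<open>expectation w = c\<close> by (simp add: d_def[abs_def] prob_space)
  let ?D = "density M d"
  interpret D: prob_space ?D
    by (rule prob_spaceI) (simp add: emeasure_density nn_integral_eq_integral int_d d0 d1)
  have "distr ?D borel X = distr M borel X"
  proof (rule Levy_uniqueness)
    show "real_distribution (distr ?D borel X)"
      by (rule D.real_distribution_distr) simp
    show "real_distribution (distr M borel X)" by simp
    show "char (distr ?D borel X) = char (distr M borel X)"
    proof
      fix s
      have I: "integrable M (\<lambda>\<omega>. iexp (s * X \<omega>))"
        by (rule integrable_iexp) auto
      have Iw: "integrable M (\<lambda>\<omega>. w \<omega> * iexp (s * X \<omega>))"
        using w by (intro integrable_const_bound[of _ 1]) (auto simp: norm_mult)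
      have "char (distr ?D borel X) s = (CLINT \<omega>|M. d \<omega> *\<^sub>R iexp (s * X \<omega>))"
        using d0 by (subst char_distr) (auto simp: integral_density)
      also have "\<dots> = (CLINT \<omega>|M. (2 * iexp (s * X \<omega>) + w \<omega> * iexp (s * X \<omega>)) / (2 + c))"
        by (intro Bochner_Integration.integral_cong) (auto simp: d_def scaleR_conv_of_real field_simps)
      also have "\<dots> = (2 + c) * (CLINT \<omega>|M. iexp (s * X \<omega>)) / (2 + c)"
        using I Iw eq[of s] by (simp add: algebra_simps)
      also have "\<dots> = char (distr M borel X) s"
        using c by (simp add: char_distr del: of_real_add of_real_numeral)
      finally show "char (distr ?D borel X) s = char (distr M borel X) s" .
    qed
  qed
  then have "measure (distr ?D borel X) A = measure (distr M borel X) A" by simp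
  then have "measure ?D (X -` A \<inter> space M) = prob (X -` A \<inter> space M)"
    by (simp add: measure_distr)
  moreover have "measure ?D (X -` A \<inter> space M) = (LINT \<omega>|?D. indicator A (X \<omega>))"
    by (simp add: integral_indicator_comp)
  moreover have "\<dots> = (LINT \<omega>|M. d \<omega> * indicator A (X \<omega>))"
    using d0 by (subst integral_density) auto
  moreover have "(LINT \<omega>|M. d \<omega> * indicator A (X \<omega>))
      = (2 * expectation (\<lambda>\<omega>. indicator A (X \<omega>)) + expectation (\<lambda>\<omega>. w \<omega> * indicator A (X \<omega>))) / (2 + c)"
  proof -
    have "integrable M (\<lambda>\<omega>. indicator A (X \<omega>) :: real)"
      by (intro integrable_const_bound[of _ 1]) (auto simp: indicator_def)
    moreover have "integrable M (\<lambda>\<omega>. w \<omega> * indicator A (X \<omega>))"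
      using w by (intro integrable_const_bound[of _ 1]) (auto simp: indicator_def)
    moreover have "(\<lambda>\<omega>. d \<omega> * indicator A (X \<omega>)) = (\<lambda>\<omega>. (2 * indicator A (X \<omega>) + w \<omega> * indicator A (X \<omega>)) / (2 + c))"
      by (auto simp: d_def field_simps)
    ultimately show ?thesis by simp
  qed
  moreover have "expectation (\<lambda>\<omega>. indicator A (X \<omega>)) = prob (X -` A \<inter> space M)"
    by (rule integral_indicator_comp)
  ultimately show ?thesis
    using c by (simp add: field_simps)
qed

text \<open>
  Kac's theorem, reduced to the uniqueness theorem on the line. With the weights \<open>cos (t V)\<close> and
  \<open>sin (t V)\<close> the factorisation in the first variable passes from exponentials to events in \<open>X\<close>;
  with the indicators of these events as weights it passes to events in \<open>V\<close>.
\<close>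

lemma (in prob_space) pair_law_eqI:
  fixes X V :: "'a \<Rightarrow> real"
  assumes [measurable]: "X \<in> borel_measurable M" "V \<in> borel_measurable M"
    and factor: "\<And>s t. (CLINT \<omega>|M. iexp (s * X \<omega> + t * V \<omega>))
      = (CLINT \<omega>|M. iexp (s * X \<omega>)) * (CLINT \<omega>|M. iexp (t * V \<omega>))"
  shows "distr M (borel \<Otimes>\<^sub>M borel) (\<lambda>\<omega>. (X \<omega>, V \<omega>)) = distr M borel X \<Otimes>\<^sub>M distr M borel V"
proof -
  have I: "integrable M (\<lambda>\<omega>. iexp (Z \<omega>))" if "Z \<in> borel_measurable M" for Z
    using that by (intro integrable_iexp) auto
  have Ip: "integrable M (\<lambda>\<omega>. iexp (s * X \<omega> + t * V \<omega>))" for s t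
    by (rule I) simp
  have int: "integrable M Z" if "Z \<in> borel_measurable M" "\<And>\<omega>. \<bar>Z \<omega>\<bar> \<le> 1" for Z :: "'a \<Rightarrow> real"
    using that by (intro integrable_const_bound[of _ 1]) auto
  have CV: "(CLINT \<omega>|M. iexp (t * V \<omega>)) = Complex (expectation (\<lambda>\<omega>. cos (t * V \<omega>))) (expectation (\<lambda>\<omega>. sin (t * V \<omega>)))" for t
  proof -
    have "(CLINT \<omega>|M. iexp (t * V \<omega>)) = (CLINT \<omega>|M. complex_of_real (cos (t * V \<omega>)) + \<i> * complex_of_real (sin (t * V \<omega>)))"
      by (intro Bochner_Integration.integral_cong) (auto simp: exp_eq_polar cis.ctr complex_eq_iff Re_exp Im_exp)
    also have "\<dots> = complex_of_real (expectation (\<lambda>\<omega>. cos (t * V \<omega>))) + \<i> * complex_of_real (expectation (\<lambda>\<omega>. sin (t * V \<omega>)))"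
      by (subst Bochner_Integration.integral_add) (auto simp: integral_complex_of_real intro!: int integrable_of_real integrable_mult_right)
    finally show ?thesis by (simp add: complex_eq_iff)
  qed
  have cos_weight: "expectation (\<lambda>\<omega>. cos (t * V \<omega>) * indicator A (X \<omega>)) = expectation (\<lambda>\<omega>. cos (t * V \<omega>)) * prob (X -` A \<inter> space M)"
    if [measurable]: "A \<in> sets borel" for t A
  proof (rule weighted_law_eqI)
    fix s
    have "(CLINT \<omega>|M. cos (t * V \<omega>) * iexp (s * X \<omega>)) =
      (CLINT \<omega>|M. (iexp (s * X \<omega> + t * V \<omega>) + iexp (s * X \<omega> + (- t) * V \<omega>)) / 2)"
      by (intro Bochner_Integration.integral_cong)
         (auto simp: complex_eq_iff Re_exp Im_exp cos_add sin_add cos_diff sin_diff field_simps)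
    also have "\<dots> = ((CLINT \<omega>|M. iexp (s * X \<omega> + t * V \<omega>)) + (CLINT \<omega>|M. iexp (s * X \<omega> + (- t) * V \<omega>))) / 2"
      by (simp only: integral_divide_zero Bochner_Integration.integral_add[OF Ip Ip])
    also have "\<dots> = expectation (\<lambda>\<omega>. cos (t * V \<omega>)) * (CLINT \<omega>|M. iexp (s * X \<omega>))"
      by (simp only: factor CV) (simp add: complex_eq_iff algebra_simps)
    finally show "(CLINT \<omega>|M. cos (t * V \<omega>) * iexp (s * X \<omega>)) = \<dots>" .
  qed auto
  have sin_weight: "expectation (\<lambda>\<omega>. sin (t * V \<omega>) * indicator A (X \<omega>)) = expectation (\<lambda>\<omega>. sin (t * V \<omega>)) * prob (X -` A \<inter> space M)"
    if [measurable]: "A \<in> sets borel" for t A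
  proof (rule weighted_law_eqI)
    fix s
    have "(CLINT \<omega>|M. sin (t * V \<omega>) * iexp (s * X \<omega>)) =
      (CLINT \<omega>|M. (iexp (s * X \<omega> + t * V \<omega>) - iexp (s * X \<omega> + (- t) * V \<omega>)) / (2 * \<i>))"
      by (intro Bochner_Integration.integral_cong)
         (auto simp: complex_eq_iff Re_exp Im_exp cos_add sin_add cos_diff sin_diff Re_divide Im_divide field_simps power2_eq_square)
    also have "\<dots> = ((CLINT \<omega>|M. iexp (s * X \<omega> + t * V \<omega>)) - (CLINT \<omega>|M. iexp (s * X \<omega> + (- t) * V \<omega>))) / (2 * \<i>)"
      by (simp only: integral_divide_zero Bochner_Integration.integral_diff[OF Ip Ip])
    also have "\<dots> = expectation (\<lambda>\<omega>. sin (t * V \<omega>)) * (CLINT \<omega>|M. iexp (s * X \<omega>))"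
      by (simp only: factor CV) (simp add: complex_eq_iff Re_divide Im_divide algebra_simps power2_eq_square)
    finally show "(CLINT \<omega>|M. sin (t * V \<omega>) * iexp (s * X \<omega>)) = \<dots>" .
  qed auto
  have prod: "prob (X -` A \<inter> V -` B \<inter> space M) = prob (X -` A \<inter> space M) * prob (V -` B \<inter> space M)"
    if [measurable]: "A \<in> sets borel" "B \<in> sets borel" for A B
  proof -
    have "expectation (\<lambda>\<omega>. indicator A (X \<omega>) * indicator B (V \<omega>)) = prob (X -` A \<inter> space M) * prob (V -` B \<inter> space M)"
    proof (rule weighted_law_eqI)
      fix t
      have "(CLINT \<omega>|M. (indicator A (X \<omega>) :: real) * iexp (t * V \<omega>)) =
        (CLINT \<omega>|M. complex_of_real (cos (t * V \<omega>) * indicator A (X \<omega>)) + \<i> * complex_of_real (sin (t * V \<omega>) * indicator A (X \<omega>)))"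
        by (intro Bochner_Integration.integral_cong) (auto simp: complex_eq_iff Re_exp Im_exp)
      also have "\<dots> = complex_of_real (expectation (\<lambda>\<omega>. cos (t * V \<omega>) * indicator A (X \<omega>)))
          + \<i> * complex_of_real (expectation (\<lambda>\<omega>. sin (t * V \<omega>) * indicator A (X \<omega>)))"
        by (subst Bochner_Integration.integral_add)
           (auto simp: integral_complex_of_real indicator_def simp del: of_real_mult intro!: int integrable_of_real integrable_mult_right)
      also have "\<dots> = prob (X -` A \<inter> space M) * (CLINT \<omega>|M. iexp (t * V \<omega>))"
        by (simp only: cos_weight[OF that(1)] sin_weight[OF that(1)] CV) (simp add: complex_eq_iff)
      finally show "(CLINT \<omega>|M. (indicator A (X \<omega>) :: real) * iexp (t * V \<omega>)) = \<dots>" .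
    qed (auto simp: indicator_def)
    moreover have "expectation (\<lambda>\<omega>. indicator A (X \<omega>) * indicator B (V \<omega>)) = prob (X -` A \<inter> V -` B \<inter> space M)"
      using integral_indicator_comp[where A="A \<times> B" and X="\<lambda>\<omega>. (X \<omega>, V \<omega>)" and M=M]
      by (simp add: indicator_times vimage_def Int_def conj_ac)
    ultimately show ?thesis by simp
  qed
  interpret X: prob_space "distr M borel X" by (rule prob_space_distr) simp
  interpret V: prob_space "distr M borel V" by (rule prob_space_distr) simp
  show ?thesis
  proof (rule pair_measure_eqI[symmetric])
    fix A B assume "A \<in> sets (distr M borel X)" "B \<in> sets (distr M borel V)"
    then have [measurable]: "A \<in> sets borel" "B \<in> sets borel" by auto
    have "emeasure (distr M (borel \<Otimes>\<^sub>M borel) (\<lambda>\<omega>. (X \<omega>, V \<omega>))) (A \<times> B) = prob (X -` A \<inter> V -` B \<inter> space M)"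
      by (subst emeasure_distr) (auto simp: emeasure_eq_measure intro!: arg_cong[of _ _ prob])
    then show "emeasure (distr M borel X) A * emeasure (distr M borel V) B
        = emeasure (distr M (borel \<Otimes>\<^sub>M borel) (\<lambda>\<omega>. (X \<omega>, V \<omega>))) (A \<times> B)"
      by (simp add: prod emeasure_distr emeasure_eq_measure ennreal_mult)
  qed (auto intro: X.sigma_finite_measure_axioms V.sigma_finite_measure_axioms)
qed

section \<open>Bivariate Gaussian vectors\<close>

lemma (in pair_sigma_finite) product_integral:
  fixes F :: "'a \<Rightarrow> real" and G :: "'b \<Rightarrow> real"
  assumes F: "integrable M1 F" and G: "integrable M2 G"
  shows integrable_product: "integrable (M1 \<Otimes>\<^sub>M M2) (\<lambda>(x, y). F x * G y)"
    and integral_product: "(LINT (x, y)|(M1 \<Otimes>\<^sub>M M2). F x * G y) = (LINT x|M1. F x) * (LINT y|M2. G y)"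
proof -
  have [measurable]: "F \<in> borel_measurable M1" "G \<in> borel_measurable M2"
    using F G by auto
  show I: "integrable (M1 \<Otimes>\<^sub>M M2) (\<lambda>(x, y). F x * G y)"
    using F G by (intro Fubini_integrable) (auto simp: abs_mult)
  show "(LINT (x, y)|(M1 \<Otimes>\<^sub>M M2). F x * G y) = (LINT x|M1. F x) * (LINT y|M2. G y)"
    using integral_fst'[OF I] by simp
qed

interpretation std_normal: prob_space std_normal_distribution
  by (rule prob_space_normal_density) simp

interpretation std_normal_pair: pair_prob_space std_normal_distribution std_normal_distribution ..

lemma std_normal_moments:
  "integrable std_normal_distribution (\<lambda>x. x)" "(LINT x|std_normal_distribution. x) = 0"
  "integrable std_normal_distribution (\<lambda>x. x\<^sup>2)" "(LINT x|std_normal_distribution. x\<^sup>2) = 1"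
  using integrable_std_normal_distribution_moment[of 1] integral_std_normal_distribution_moment_odd[of 1]
    integrable_std_normal_distribution_moment[of 2] std_normal_distribution_even_moments[of 1]
  by auto

text \<open>
  The density, relative to the product of two standard normal laws, of the law of a centered
  Gaussian pair with unit variances and correlation \<open>\<rho>\<close>, where \<open>\<rho>\<^sup>2 < 1\<close>.
\<close>

definition mehler_kernel :: "real \<Rightarrow> real \<Rightarrow> real \<Rightarrow> real" where
  "mehler_kernel \<rho> x y = normal_density (\<rho> * x) (sqrt (1 - \<rho>\<^sup>2)) y / std_normal_density y"

lemma measurable_mehler_kernel [measurable (raw)]:
  assumes [measurable]: "F \<in> borel_measurable M" "G \<in> borel_measurable M"
  shows "(\<lambda>x. mehler_kernel \<rho> (F x) (G x)) \<in> borel_measurable M"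
  unfolding mehler_kernel_def normal_density_def by measurable

text \<open>
  Integrating against the kernel amounts to conditioning on the first variable: given \<open>x\<close>, the second
  one is distributed as \<open>\<rho> x + sqrt (1 - \<rho>\<^sup>2) v\<close> with \<open>v\<close> standard normal.
\<close>

lemma integral_mehler_kernel:
  fixes F :: "real \<Rightarrow> real"
  assumes \<rho>: "\<rho>\<^sup>2 < 1" and [measurable]: "F \<in> borel_measurable borel"
  shows "(LINT y|std_normal_distribution. F y * mehler_kernel \<rho> x y)
    = (LINT v|std_normal_distribution. F (\<rho> * x + sqrt (1 - \<rho>\<^sup>2) * v))"
proof -
  define \<sigma> where "\<sigma> = sqrt (1 - \<rho>\<^sup>2)"
  have \<sigma>: "\<sigma> > 0" using \<rho> by (simp add: \<sigma>_def)
  have scale: "\<sigma> * normal_density (\<rho> * x) \<sigma> (\<rho> * x + \<sigma> * v) = std_normal_density v" for v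
    using \<sigma> by (simp add: normal_density_def power_mult_distrib real_sqrt_mult)
  have "(LINT y|std_normal_distribution. F y * mehler_kernel \<rho> x y)
      = (LINT y|lborel. std_normal_density y * (F y * mehler_kernel \<rho> x y))"
    by (subst integral_density) auto
  also have "\<dots> = (LINT y|lborel. F y * normal_density (\<rho> * x) \<sigma> y)"
    using normal_density_pos[of 1 0]
    by (intro Bochner_Integration.integral_cong) (auto simp: mehler_kernel_def \<sigma>_def less_imp_neq[symmetric])
  also have "\<dots> = (LINT v|lborel. std_normal_density v * F (\<rho> * x + \<sigma> * v))"
  proof -
    have "(LINT y|lborel. F y * normal_density (\<rho> * x) \<sigma> y) =
        (LINT v|lborel. \<sigma> * (F (\<rho> * x + \<sigma> * v) * normal_density (\<rho> * x) \<sigma> (\<rho> * x + \<sigma> * v)))"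
      using \<sigma> by (subst lborel_integral_real_affine[where t="\<rho> * x" and c=\<sigma>]) auto
    also have "\<dots> = (LINT v|lborel. std_normal_density v * F (\<rho> * x + \<sigma> * v))"
      by (simp only: scale[symmetric] mult_ac)
    finally show ?thesis .
  qed
  also have "\<dots> = (LINT v|std_normal_distribution. F (\<rho> * x + \<sigma> * v))"
    by (subst integral_density) auto
  finally show ?thesis by (simp add: \<sigma>_def)
qed

text \<open>
  Completing the square exhibits the squared kernel, weighted by the product density, as a multiple
  of a Gaussian density in \<open>y\<close> for given \<open>x\<close>, times a Gaussian density in \<open>x\<close>. The two standard
  deviations are reciprocal, so that their normalising constants cancel.
\<close>

lemma mehler_kernel_square_density:
  fixes x y :: real
  assumes \<rho>: "\<rho>\<^sup>2 < 1"
  defines "\<tau> \<equiv> sqrt ((1 - \<rho>\<^sup>2) / (1 + \<rho>\<^sup>2))"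
  shows "(mehler_kernel \<rho> x y)\<^sup>2 * std_normal_density y * std_normal_density x
    = normal_density (2 * \<rho> * x / (1 + \<rho>\<^sup>2)) \<tau> y * (normal_density 0 (1 / \<tau>) x / (1 - \<rho>\<^sup>2))"
proof -
  define p where "p = \<rho>\<^sup>2"
  have p: "0 \<le> p" "p < 1" using \<rho> by (auto simp: p_def)
  have \<tau>2: "\<tau>\<^sup>2 = (1 - p) / (1 + p)"
    using p by (simp add: \<tau>_def p_def)
  have e: "- (y - \<rho> * x)\<^sup>2 / (2 * (1 - p)) * 2 + y\<^sup>2 / 2 - x\<^sup>2 / 2
      = - (y - 2 * \<rho> * x / (1 + p))\<^sup>2 / (2 * ((1 - p) / (1 + p))) - x\<^sup>2 / (2 * ((1 + p) / (1 - p)))"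
  proof -
    define q r where "q = 1 + p" "r = 1 - p"
    have nz: "q \<noteq> 0" "r \<noteq> 0" using p by (auto simp: q_r_def)
    have poly: "- 2 * q * (y - \<rho> * x)\<^sup>2 + (y\<^sup>2 - x\<^sup>2) * q * r = - (q * y - 2 * \<rho> * x)\<^sup>2 - x\<^sup>2 * r\<^sup>2"
      unfolding q_r_def p_def by algebra
    have z: "y - 2 * \<rho> * x / q = (q * y - 2 * \<rho> * x) / q"
      using nz by (simp add: diff_divide_distrib)
    have N: "- (N / q)\<^sup>2 / (2 * (r / q)) - x\<^sup>2 / (2 * (q / r)) = (- N\<^sup>2 - x\<^sup>2 * r\<^sup>2) / (2 * q * r)" for N
    proof -
      have "(N / q)\<^sup>2 / (2 * (r / q)) = N\<^sup>2 / (2 * q * r)"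
        using nz by (simp add: power2_eq_square)
      moreover have "x\<^sup>2 / (2 * (q / r)) = x\<^sup>2 * r\<^sup>2 / (2 * q * r)"
        using nz by (simp add: power2_eq_square)
      ultimately show ?thesis by (simp add: diff_divide_distrib)
    qed
    have P: "(- 2 * q * A + B * q * r) / (2 * q * r) = - A / (2 * r) * 2 + B / 2" for A B
      using nz by (simp add: field_simps)
    have "- (y - 2 * \<rho> * x / q)\<^sup>2 / (2 * (r / q)) - x\<^sup>2 / (2 * (q / r))
        = (- (q * y - 2 * \<rho> * x)\<^sup>2 - x\<^sup>2 * r\<^sup>2) / (2 * q * r)"
      unfolding z by (rule N)
    also have "\<dots> = - (y - \<rho> * x)\<^sup>2 / (2 * r) * 2 + y\<^sup>2 / 2 - x\<^sup>2 / 2"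
      unfolding poly[symmetric] P by (simp add: diff_divide_distrib)
    finally show ?thesis by (simp add: q_r_def)
  qed
  have L: "(mehler_kernel \<rho> x y)\<^sup>2 * std_normal_density y * std_normal_density x
      = 1 / (2 * pi * (1 - p)) * exp (- (y - \<rho> * x)\<^sup>2 / (2 * (1 - p)) * 2 + y\<^sup>2 / 2 - x\<^sup>2 / 2)"
  proof -
    define G where "G = normal_density (\<rho> * x) (sqrt (1 - p)) y"
    have G: "G\<^sup>2 = 1 / (2 * pi * (1 - p)) * exp (- (y - \<rho> * x)\<^sup>2 / (2 * (1 - p)) * 2)"
      using p unfolding G_def normal_density_def power_mult_distrib power_divide
      by (simp add: exp_double[symmetric])
    have S: "std_normal_density x = std_normal_density y * exp (y\<^sup>2 / 2 - x\<^sup>2 / 2)"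
      by (simp add: std_normal_density_def flip: exp_add)
    have "(mehler_kernel \<rho> x y)\<^sup>2 * std_normal_density y * std_normal_density x
        = G\<^sup>2 * exp (y\<^sup>2 / 2 - x\<^sup>2 / 2)"
      unfolding S mehler_kernel_def p_def[symmetric] G_def[symmetric]
      using normal_density_pos[of 1 0 y] by (simp add: power_divide power2_eq_square)
    also have "\<dots> = 1 / (2 * pi * (1 - p)) * exp (- (y - \<rho> * x)\<^sup>2 / (2 * (1 - p)) * 2 + (y\<^sup>2 / 2 - x\<^sup>2 / 2))"
      unfolding G exp_add by simp
    finally show ?thesis by (simp only: add_diff_eq)
  qed
  have "sqrt (2 * pi * \<tau>\<^sup>2) * sqrt (2 * pi * (1 / \<tau>)\<^sup>2) = sqrt ((2 * pi)\<^sup>2)"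
    using p unfolding real_sqrt_mult[symmetric] power_divide \<tau>2
    by (simp add: power2_eq_square)
  then have c: "sqrt (2 * pi * \<tau>\<^sup>2) * sqrt (2 * pi * (1 / \<tau>)\<^sup>2) = 2 * pi"
    by (simp only: real_sqrt_abs) simp
  have "normal_density (2 * \<rho> * x / (1 + p)) \<tau> y * (normal_density 0 (1 / \<tau>) x / (1 - p))
      = 1 / (sqrt (2 * pi * \<tau>\<^sup>2) * sqrt (2 * pi * (1 / \<tau>)\<^sup>2) * (1 - p))
        * exp (- (y - 2 * \<rho> * x / (1 + p))\<^sup>2 / (2 * \<tau>\<^sup>2) + - (x - 0)\<^sup>2 / (2 * (1 / \<tau>)\<^sup>2))"
    unfolding normal_density_def exp_add by simp
  also have "\<dots> = 1 / (2 * pi * (1 - p)) * exp (- (y - 2 * \<rho> * x / (1 + p))\<^sup>2 / (2 * ((1 - p) / (1 + p))) - x\<^sup>2 / (2 * ((1 + p) / (1 - p))))"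
    unfolding c by (simp add: \<tau>2 power_divide)
  finally show ?thesis
    unfolding L e by (simp add: p_def)
qed

lemma
  assumes \<rho>: "\<rho>\<^sup>2 < 1"
  shows integrable_mehler_kernel_square:
      "integrable (std_normal_distribution \<Otimes>\<^sub>M std_normal_distribution) (\<lambda>(x, y). (mehler_kernel \<rho> x y)\<^sup>2)"
    and integral_mehler_kernel_square:
      "(LINT (x, y)|(std_normal_distribution \<Otimes>\<^sub>M std_normal_distribution). (mehler_kernel \<rho> x y)\<^sup>2) = 1 / (1 - \<rho>\<^sup>2)"
proof -
  define \<tau> where "\<tau> = sqrt ((1 - \<rho>\<^sup>2) / (1 + \<rho>\<^sup>2))"
  have "1 + \<rho>\<^sup>2 > 0" by (simp add: add_pos_nonneg)
  then have \<tau>: "\<tau> > 0" using \<rho> by (simp add: \<tau>_def)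
  have inner: "(\<integral>\<^sup>+y. ennreal ((mehler_kernel \<rho> x y)\<^sup>2) \<partial>std_normal_distribution) * std_normal_density x
      = ennreal (normal_density 0 (1 / \<tau>) x / (1 - \<rho>\<^sup>2))" for x
  proof -
    have "(\<integral>\<^sup>+y. ennreal ((mehler_kernel \<rho> x y)\<^sup>2) \<partial>std_normal_distribution) * std_normal_density x
        = (\<integral>\<^sup>+y. std_normal_density y * ennreal ((mehler_kernel \<rho> x y)\<^sup>2) * std_normal_density x \<partial>lborel)"
      by (subst nn_integral_density) (auto simp: nn_integral_multc)
    also have "\<dots> = (\<integral>\<^sup>+y. ennreal (normal_density (2 * \<rho> * x / (1 + \<rho>\<^sup>2)) \<tau> y) * (normal_density 0 (1 / \<tau>) x / (1 - \<rho>\<^sup>2)) \<partial>lborel)"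
      using mehler_kernel_square_density[OF \<rho>, of x] \<rho>
      by (intro nn_integral_cong) (simp add: ennreal_mult[symmetric] \<tau>_def mult.commute mult.left_commute)
    also have "\<dots> = ennreal (normal_density 0 (1 / \<tau>) x / (1 - \<rho>\<^sup>2))"
      using \<tau> by (simp add: nn_integral_multc nn_integral_eq_integral)
    finally show ?thesis .
  qed
  have nn: "(\<integral>\<^sup>+z. ennreal (case z of (x, y) \<Rightarrow> (mehler_kernel \<rho> x y)\<^sup>2) \<partial>(std_normal_distribution \<Otimes>\<^sub>M std_normal_distribution))
      = ennreal (1 / (1 - \<rho>\<^sup>2))"
  proof -
    have "(\<integral>\<^sup>+z. ennreal (case z of (x, y) \<Rightarrow> (mehler_kernel \<rho> x y)\<^sup>2) \<partial>(std_normal_distribution \<Otimes>\<^sub>M std_normal_distribution))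
        = (\<integral>\<^sup>+x. (\<integral>\<^sup>+y. ennreal ((mehler_kernel \<rho> x y)\<^sup>2) \<partial>std_normal_distribution) \<partial>std_normal_distribution)"
      by (subst std_normal.nn_integral_fst[symmetric]) auto
    also have "\<dots> = (\<integral>\<^sup>+x. std_normal_density x * (\<integral>\<^sup>+y. ennreal ((mehler_kernel \<rho> x y)\<^sup>2) \<partial>std_normal_distribution) \<partial>lborel)"
      by (subst nn_integral_density) (auto intro!: std_normal.borel_measurable_nn_integral)
    also have "\<dots> = (\<integral>\<^sup>+x. ennreal (normal_density 0 (1 / \<tau>) x / (1 - \<rho>\<^sup>2)) \<partial>lborel)"
      by (simp only: inner[symmetric] mult.commute)
    also have "\<dots> = ennreal (1 / (1 - \<rho>\<^sup>2))"
      using \<tau> \<rho> by (subst nn_integral_eq_integral) auto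
    finally show ?thesis .
  qed
  show "integrable (std_normal_distribution \<Otimes>\<^sub>M std_normal_distribution) (\<lambda>(x, y). (mehler_kernel \<rho> x y)\<^sup>2)"
    by (rule integrableI_nonneg) (auto simp: nn)
  show "(LINT (x, y)|(std_normal_distribution \<Otimes>\<^sub>M std_normal_distribution). (mehler_kernel \<rho> x y)\<^sup>2) = 1 / (1 - \<rho>\<^sup>2)"
    using \<rho> by (subst integral_eq_nn_integral) (auto simp: nn)
qed

text \<open>
  A function orthogonal to \<open>1\<close> and \<open>x\<close> does not see the terms \<open>1 + \<rho> x y\<close> of the kernel \<open>h\<close>, so the
  covariance is the integral of \<open>R(x) R(y)\<close> against \<open>h - 1 - \<rho> x y\<close>. The squared norm of this
  remainder is \<open>1 / (1 - \<rho>\<^sup>2) - 1 - \<rho>\<^sup>2 = \<rho>\<^sup>4 / (1 - \<rho>\<^sup>2)\<close>, and the Cauchy-Schwarz inequality replaces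
  the expansion in Hermite polynomials.
\<close>

lemma (in prob_space) correlated_std_normal_integral_bound:
  fixes X V Z :: "'a \<Rightarrow> real" and R :: "real \<Rightarrow> real"
  assumes [measurable]: "X \<in> borel_measurable M" "V \<in> borel_measurable M" "R \<in> borel_measurable borel"
    and law: "distr M (borel \<Otimes>\<^sub>M borel) (\<lambda>\<omega>. (X \<omega>, V \<omega>)) = std_normal_distribution \<Otimes>\<^sub>M std_normal_distribution"
    and Z: "\<And>\<omega>. Z \<omega> = \<rho> * X \<omega> + sqrt (1 - \<rho>\<^sup>2) * V \<omega>"
    and \<rho>: "\<rho>\<^sup>2 < 1"
    and RX: "integrable M (\<lambda>\<omega>. (R (X \<omega>))\<^sup>2)" and RZ: "integrable M (\<lambda>\<omega>. (R (Z \<omega>))\<^sup>2)"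
    and sq: "integrable std_normal_distribution (\<lambda>x. (R x)\<^sup>2)"
    and orth0: "(LINT x|std_normal_distribution. R x) = 0"
    and orth1: "(LINT x|std_normal_distribution. x * R x) = 0"
  shows "(expectation (\<lambda>\<omega>. R (X \<omega>) * R (Z \<omega>)))\<^sup>2
    \<le> (LINT x|std_normal_distribution. (R x)\<^sup>2)\<^sup>2 * (\<rho>^4 / (1 - \<rho>\<^sup>2))"
proof -
  let ?S = "std_normal_distribution" and ?SS = "std_normal_distribution \<Otimes>\<^sub>M std_normal_distribution"
  let ?h = "mehler_kernel \<rho>"
  have [measurable]: "Z \<in> borel_measurable M" unfolding Z[abs_def] by measurable
  note square_integrable = std_normal_pair.square_integrable_imp_integrable
  have R1: "integrable ?S R"
    by (rule std_normal.square_integrable_imp_integrable[OF _ sq]) simp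
  have xR: "integrable ?S (\<lambda>x. x * R x)"
    by (rule integrable_mult_square[OF _ _ std_normal_moments(3) sq]) auto
  have h2: "integrable ?SS (\<lambda>z. (?h (fst z) (snd z))\<^sup>2)" "(LINT z|?SS. (?h (fst z) (snd z))\<^sup>2) = 1 / (1 - \<rho>\<^sup>2)"
    using integrable_mehler_kernel_square[OF \<rho>] integral_mehler_kernel_square[OF \<rho>]
    by (simp_all add: case_prod_beta')
  have h_measurable [measurable]: "(\<lambda>z. ?h (fst z) (snd z)) \<in> borel_measurable ?SS"
    by measurable
  have h1: "integrable ?SS (\<lambda>z. ?h (fst z) (snd z))"
    by (rule square_integrable[OF h_measurable h2(1)])
  have xy2: "integrable ?SS (\<lambda>z. (fst z * snd z)\<^sup>2)" "(LINT z|?SS. (fst z * snd z)\<^sup>2) = 1"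
    using std_normal_pair.integrable_product[OF std_normal_moments(3,3)]
      std_normal_pair.integral_product[OF std_normal_moments(3,3)] std_normal_moments(4)
    by (simp_all add: case_prod_beta' power_mult_distrib)
  have xy: "integrable ?SS (\<lambda>z. fst z * snd z)" "(LINT z|?SS. fst z * snd z) = 0"
    using std_normal_pair.integrable_product[OF std_normal_moments(1,1)]
      std_normal_pair.integral_product[OF std_normal_moments(1,1)] std_normal_moments(2)
    by (simp_all add: case_prod_beta')
  have RR2: "integrable ?SS (\<lambda>z. (R (fst z) * R (snd z))\<^sup>2)"
    "(LINT z|?SS. (R (fst z) * R (snd z))\<^sup>2) = (LINT x|?S. (R x)\<^sup>2)\<^sup>2"
    using std_normal_pair.integrable_product[OF sq sq] std_normal_pair.integral_product[OF sq sq]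
    by (simp_all add: case_prod_beta' power_mult_distrib power2_eq_square[of "LINT x|?S. (R x)\<^sup>2"])
  have RR: "integrable ?SS (\<lambda>z. R (fst z) * R (snd z))" "(LINT z|?SS. R (fst z) * R (snd z)) = 0"
    using std_normal_pair.integrable_product[OF R1 R1] std_normal_pair.integral_product[OF R1 R1] orth0
    by (simp_all add: case_prod_beta')
  have xyRR: "integrable ?SS (\<lambda>z. (fst z * snd z) * (R (fst z) * R (snd z)))"
    "(LINT z|?SS. (fst z * snd z) * (R (fst z) * R (snd z))) = 0"
    using std_normal_pair.integrable_product[OF xR xR] std_normal_pair.integral_product[OF xR xR] orth1
    by (simp_all add: case_prod_beta' mult_ac)
  have hxy: "integrable ?SS (\<lambda>z. ?h (fst z) (snd z) * (fst z * snd z))"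
    by (rule integrable_mult_square[OF _ _ h2(1) xy2(1)]) auto
  have hRR: "integrable ?SS (\<lambda>z. ?h (fst z) (snd z) * (R (fst z) * R (snd z)))"
    by (rule integrable_mult_square[OF _ _ h2(1) RR2(1)]) auto

  have int_h: "(LINT z|?SS. ?h (fst z) (snd z)) = 1"
    using std_normal_pair.integral_fst'[OF h1] integral_mehler_kernel[OF \<rho>, of "\<lambda>_. 1"]
      std_normal.prob_space by simp
  have int_hxy: "(LINT z|?SS. ?h (fst z) (snd z) * (fst z * snd z)) = \<rho>"
  proof -
    have "(LINT z|?SS. ?h (fst z) (snd z) * (fst z * snd z)) = (LINT x|?S. LINT y|?S. ?h x y * (x * y))"
      using std_normal_pair.integral_fst'[OF hxy] by simp
    also have "\<dots> = (LINT x|?S. x * (LINT y|?S. y * ?h x y))"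
      by (simp only: integral_mult_right_zero[symmetric] mult_ac)
    also have "\<dots> = (LINT x|?S. \<rho> * x\<^sup>2)"
    proof -
      have "(LINT y|?S. y * ?h x y) = \<rho> * x" for x
      proof -
        have "(LINT y|?S. y * ?h x y) = (LINT v|?S. \<rho> * x + sqrt (1 - \<rho>\<^sup>2) * v)"
          by (rule integral_mehler_kernel[OF \<rho>]) simp
        also have "\<dots> = (LINT v|?S. \<rho> * x) + sqrt (1 - \<rho>\<^sup>2) * (LINT v|?S. v)"
          by (subst Bochner_Integration.integral_add) (simp_all add: std_normal_moments(1))
        finally show ?thesis
          using std_normal.prob_space by (simp add: std_normal_moments(2))
      qed
      then show ?thesis by (simp add: power2_eq_square mult.left_commute)
    qed
    also have "\<dots> = \<rho>"
      by (simp add: std_normal_moments(4))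
    finally show ?thesis .
  qed
  have int_hRR: "(LINT z|?SS. ?h (fst z) (snd z) * (R (fst z) * R (snd z))) = expectation (\<lambda>\<omega>. R (X \<omega>) * R (Z \<omega>))"
  proof -
    let ?g = "\<lambda>(x, v). R x * R (\<rho> * x + sqrt (1 - \<rho>\<^sup>2) * v)"
    have g [measurable]: "?g \<in> borel_measurable (borel \<Otimes>\<^sub>M borel)" by measurable
    have int: "integrable M (\<lambda>\<omega>. R (X \<omega>) * R (Z \<omega>))"
      by (rule integrable_mult_square[OF _ _ RX RZ]) auto
    then have "integrable (distr M (borel \<Otimes>\<^sub>M borel) (\<lambda>\<omega>. (X \<omega>, V \<omega>))) ?g"
      by (subst integrable_distr_eq) (auto simp: Z)
    then have int_g: "integrable ?SS ?g" by (simp only: law)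
    have "expectation (\<lambda>\<omega>. R (X \<omega>) * R (Z \<omega>)) = integral\<^sup>L (distr M (borel \<Otimes>\<^sub>M borel) (\<lambda>\<omega>. (X \<omega>, V \<omega>))) ?g"
      by (subst integral_distr) (auto simp: Z)
    also have "\<dots> = (LINT x|?S. LINT v|?S. R x * R (\<rho> * x + sqrt (1 - \<rho>\<^sup>2) * v))"
      using std_normal_pair.integral_fst'[OF int_g] by (simp only: law) simp
    also have "\<dots> = (LINT x|?S. R x * (LINT y|?S. R y * ?h x y))"
      by (simp add: integral_mehler_kernel[OF \<rho>, of R])
    also have "\<dots> = (LINT x|?S. LINT y|?S. ?h x y * (R x * R y))"
      by (simp only: integral_mult_right_zero[symmetric] mult_ac)
    also have "\<dots> = (LINT z|?SS. ?h (fst z) (snd z) * (R (fst z) * R (snd z)))"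
      using std_normal_pair.integral_fst'[OF hRR] by simp
    finally show ?thesis by simp
  qed

  \<comment> \<open>The part of the density that a function orthogonal to \<open>1\<close> and \<open>x\<close> can see.\<close>
  define D where "D z = ?h (fst z) (snd z) - 1 - \<rho> * (fst z * snd z)" for z
  have [measurable]: "D \<in> borel_measurable ?SS" unfolding D_def[abs_def] by simp
  have D_square: "(\<lambda>z. (D z)\<^sup>2) = (\<lambda>z. (?h (fst z) (snd z))\<^sup>2 + 1 + \<rho>\<^sup>2 * (fst z * snd z)\<^sup>2
      - 2 * ?h (fst z) (snd z) - 2 * \<rho> * (?h (fst z) (snd z) * (fst z * snd z)) + 2 * \<rho> * (fst z * snd z))"
    by (auto simp: D_def power2_eq_square algebra_simps)
  have D2: "integrable ?SS (\<lambda>z. (D z)\<^sup>2)"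
    unfolding D_square using h2 h1 hxy xy xy2 by simp
  have "(LINT z|?SS. (D z)\<^sup>2) = 1 / (1 - \<rho>\<^sup>2) + 1 + \<rho>\<^sup>2 - 2 - 2 * \<rho> * \<rho>"
    unfolding D_square using h2 h1 hxy xy xy2 int_h int_hxy std_normal_pair.prob_space by simp
  also have "\<dots> = \<rho>^4 / (1 - \<rho>\<^sup>2)"
    using \<rho> by (simp add: field_simps power2_eq_square power4_eq_xxxx)
  finally have int_D2: "(LINT z|?SS. (D z)\<^sup>2) = \<rho>^4 / (1 - \<rho>\<^sup>2)" .
  have "(LINT z|?SS. (R (fst z) * R (snd z)) * D z) =
    (LINT z|?SS. ?h (fst z) (snd z) * (R (fst z) * R (snd z)) - R (fst z) * R (snd z)
      - \<rho> * ((fst z * snd z) * (R (fst z) * R (snd z))))"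
    by (intro Bochner_Integration.integral_cong) (auto simp: D_def algebra_simps)
  also have "\<dots> = expectation (\<lambda>\<omega>. R (X \<omega>) * R (Z \<omega>))"
    using hRR RR xyRR int_hRR by simp
  finally have "expectation (\<lambda>\<omega>. R (X \<omega>) * R (Z \<omega>)) = (LINT z|?SS. (R (fst z) * R (snd z)) * D z)" ..
  moreover have "(LINT z|?SS. (R (fst z) * R (snd z)) * D z)\<^sup>2
      \<le> (LINT z|?SS. (R (fst z) * R (snd z))\<^sup>2) * (LINT z|?SS. (D z)\<^sup>2)"
    by (rule Cauchy_Schwarz_integral[OF _ _ RR2(1) D2]) auto
  ultimately show ?thesis
    by (simp add: RR2(2) int_D2)
qed

section \<open>Spatial averages of a random field\<close>

context pair_prob_space
begin

lemma
  fixes F :: "'a \<Rightarrow> 'b \<Rightarrow> real"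
  assumes F [measurable]: "(\<lambda>(p, \<omega>). F p \<omega>) \<in> borel_measurable (M1 \<Otimes>\<^sub>M M2)"
    and sq: "\<And>p. integrable M2 (\<lambda>\<omega>. (F p \<omega>)\<^sup>2)"
    and bound: "\<And>p. M2.expectation (\<lambda>\<omega>. (F p \<omega>)\<^sup>2) \<le> B"
  shows measurable_average [measurable]: "(\<lambda>\<omega>. LINT p|M1. F p \<omega>) \<in> borel_measurable M2"
    and AE_integrable_average: "AE \<omega> in M2. integrable M1 (\<lambda>p. F p \<omega>)"
    and integrable_square_average: "integrable M2 (\<lambda>\<omega>. (LINT p|M1. F p \<omega>)\<^sup>2)"
proof -
  have [measurable]: "(\<lambda>(\<omega>, p). F p \<omega>) \<in> borel_measurable (M2 \<Otimes>\<^sub>M M1)"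
    using measurable_compose[OF measurable_pair_swap' F] by (simp add: case_prod_beta')
  show "(\<lambda>\<omega>. LINT p|M1. F p \<omega>) \<in> borel_measurable M2"
    by measurable
  have I2: "integrable (M1 \<Otimes>\<^sub>M M2) (\<lambda>(p, \<omega>). (F p \<omega>)\<^sup>2)"
  proof (rule Fubini_integrable)
    show "integrable M1 (\<lambda>p. LINT \<omega>|M2. norm (case (p, \<omega>) of (p, \<omega>) \<Rightarrow> (F p \<omega>)\<^sup>2))"
      using bound by (intro M1.integrable_const_bound[of _ B]) auto
  qed (use sq in auto)
  have I1: "integrable (M1 \<Otimes>\<^sub>M M2) (\<lambda>(p, \<omega>). F p \<omega>)"
  proof (rule P.square_integrable_imp_integrable)
    show "integrable (M1 \<Otimes>\<^sub>M M2) (\<lambda>x. (case x of (p, \<omega>) \<Rightarrow> F p \<omega>)\<^sup>2)"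
      using I2 by (simp add: case_prod_beta')
  qed simp
  show AE1: "AE \<omega> in M2. integrable M1 (\<lambda>p. F p \<omega>)"
    by (rule AE_integrable_snd[OF I1])
  have AE2: "AE \<omega> in M2. integrable M1 (\<lambda>p. (F p \<omega>)\<^sup>2)"
    by (rule AE_integrable_snd[OF I2])
  show "integrable M2 (\<lambda>\<omega>. (LINT p|M1. F p \<omega>)\<^sup>2)"
  proof (rule Bochner_Integration.integrable_bound[OF integrable_snd[OF I2]])
    show "AE \<omega> in M2. norm ((LINT p|M1. F p \<omega>)\<^sup>2) \<le> norm (LINT p|M1. (F p \<omega>)\<^sup>2)"
      using AE1 AE2 AE_space
    proof eventually_elim
      case (elim \<omega>)
      then show ?case
        using Cauchy_Schwarz_integral[of "\<lambda>p. F p \<omega>" M1 "\<lambda>_. 1"] M1.prob_space by simp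
    qed
  qed simp
qed

lemma
  fixes F :: "'a \<Rightarrow> 'b \<Rightarrow> real"
  assumes F [measurable]: "(\<lambda>(p, \<omega>). F p \<omega>) \<in> borel_measurable (M1 \<Otimes>\<^sub>M M2)"
    and sq: "\<And>p. integrable M2 (\<lambda>\<omega>. (F p \<omega>)\<^sup>2)"
    and bound: "\<And>p. M2.expectation (\<lambda>\<omega>. (F p \<omega>)\<^sup>2) \<le> B"
    and S [measurable]: "S \<in> borel_measurable M2" and S2: "integrable M2 (\<lambda>\<omega>. (S \<omega>)\<^sup>2)"
  shows integrable_expectation_mult: "integrable M1 (\<lambda>p. M2.expectation (\<lambda>\<omega>. S \<omega> * F p \<omega>))"
    and expectation_mult_average:
      "M2.expectation (\<lambda>\<omega>. S \<omega> * (LINT p|M1. F p \<omega>)) = (LINT p|M1. M2.expectation (\<lambda>\<omega>. S \<omega> * F p \<omega>))"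
proof -
  have "integrable (M1 \<Otimes>\<^sub>M M2) (\<lambda>z. S (snd z) * F (fst z) (snd z))"
  proof (rule integrable_mult_square)
    have "integrable (M1 \<Otimes>\<^sub>M M2) (\<lambda>(p, \<omega>). 1 * (S \<omega>)\<^sup>2)"
      by (rule integrable_product) (use S2 in auto)
    then show "integrable (M1 \<Otimes>\<^sub>M M2) (\<lambda>z. (S (snd z))\<^sup>2)"
      by (simp add: case_prod_beta')
    have "integrable (M1 \<Otimes>\<^sub>M M2) (\<lambda>(p, \<omega>). (F p \<omega>)\<^sup>2)"
    proof (rule Fubini_integrable)
      show "integrable M1 (\<lambda>p. LINT \<omega>|M2. norm (case (p, \<omega>) of (p, \<omega>) \<Rightarrow> (F p \<omega>)\<^sup>2))"
        using bound by (intro M1.integrable_const_bound[of _ B]) auto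
    qed (use sq in auto)
    then show "integrable (M1 \<Otimes>\<^sub>M M2) (\<lambda>z. (F (fst z) (snd z))\<^sup>2)"
      by (simp add: case_prod_beta')
    show "(\<lambda>z. F (fst z) (snd z)) \<in> borel_measurable (M1 \<Otimes>\<^sub>M M2)"
      using F by (simp add: case_prod_beta')
  qed simp
  then have I: "integrable (M1 \<Otimes>\<^sub>M M2) (\<lambda>(p, \<omega>). S \<omega> * F p \<omega>)"
    by (simp add: case_prod_beta')
  show "integrable M1 (\<lambda>p. M2.expectation (\<lambda>\<omega>. S \<omega> * F p \<omega>))"
    by (rule integrable_fst[OF I])
  show "M2.expectation (\<lambda>\<omega>. S \<omega> * (LINT p|M1. F p \<omega>)) = (LINT p|M1. M2.expectation (\<lambda>\<omega>. S \<omega> * F p \<omega>))"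
    using Fubini_integral[OF I] by simp
qed

text \<open>
  Two applications of the identity for \<open>S\<close> times an average: first with the average itself as \<open>S\<close>,
  then with a single value of the field as \<open>S\<close>.
\<close>

lemma expectation_square_average:
  fixes F :: "'a \<Rightarrow> 'b \<Rightarrow> real"
  assumes F [measurable]: "(\<lambda>(p, \<omega>). F p \<omega>) \<in> borel_measurable (M1 \<Otimes>\<^sub>M M2)"
    and FM [measurable]: "\<And>p. F p \<in> borel_measurable M2"
    and sq: "\<And>p. integrable M2 (\<lambda>\<omega>. (F p \<omega>)\<^sup>2)"
    and bound: "\<And>p. M2.expectation (\<lambda>\<omega>. (F p \<omega>)\<^sup>2) \<le> B"
  shows "M2.expectation (\<lambda>\<omega>. (LINT p|M1. F p \<omega>)\<^sup>2) = (LINT p|M1. LINT q|M1. M2.expectation (\<lambda>\<omega>. F p \<omega> * F q \<omega>))"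
    and "\<And>p. integrable M1 (\<lambda>q. M2.expectation (\<lambda>\<omega>. F p \<omega> * F q \<omega>))"
    and "integrable M1 (\<lambda>p. LINT q|M1. M2.expectation (\<lambda>\<omega>. F p \<omega> * F q \<omega>))"
proof -
  let ?Z = "\<lambda>\<omega>. LINT p|M1. F p \<omega>"
  note Z = measurable_average[OF F sq bound] integrable_square_average[OF F sq bound]
  have inner: "M2.expectation (\<lambda>\<omega>. ?Z \<omega> * F p \<omega>) = (LINT q|M1. M2.expectation (\<lambda>\<omega>. F p \<omega> * F q \<omega>))" for p
    using expectation_mult_average[OF F sq bound FM sq, of p] by (simp add: mult.commute)
  show "M2.expectation (\<lambda>\<omega>. (?Z \<omega>)\<^sup>2) = (LINT p|M1. LINT q|M1. M2.expectation (\<lambda>\<omega>. F p \<omega> * F q \<omega>))"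
    using expectation_mult_average[OF F sq bound Z] by (simp add: inner power2_eq_square)
  show "integrable M1 (\<lambda>q. M2.expectation (\<lambda>\<omega>. F p \<omega> * F q \<omega>))" for p
    by (rule integrable_expectation_mult[OF F sq bound FM sq])
  show "integrable M1 (\<lambda>p. LINT q|M1. M2.expectation (\<lambda>\<omega>. F p \<omega> * F q \<omega>))"
    using integrable_expectation_mult[OF F sq bound Z] by (simp add: inner)
qed

end

section \<open>Gaussian fields of unit variance\<close>

locale standard_gaussian_field = prob_space M
  for M :: "'w measure" and Y :: "'i::topological_space \<Rightarrow> 'w \<Rightarrow> real" +
  assumes gaussian: "gaussian_field M Y"
    and centered: "centered_field M Y"
    and measurable: "measurable_field M Y"
    and unit_variance: "\<And>p. expectation (\<lambda>\<omega>. (Y p \<omega>)\<^sup>2) = 1"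
begin

abbreviation correlation :: "'i \<Rightarrow> 'i \<Rightarrow> real" where
  "correlation p q \<equiv> expectation (\<lambda>\<omega>. Y p \<omega> * Y q \<omega>)"

lemma measurable_joint [measurable]: "(\<lambda>(p, \<omega>). Y p \<omega>) \<in> borel_measurable (borel \<Otimes>\<^sub>M M)"
  using measurable by (simp add: measurable_field_def)

lemma measurable_compose_joint [measurable (raw)]:
  assumes "f \<in> measurable K borel" "g \<in> measurable K M"
  shows "(\<lambda>x. Y (f x) (g x)) \<in> borel_measurable K"
  using measurable_compose[OF measurable_Pair[OF assms] measurable_joint] by simp

lemma measurable_value [measurable]: "Y p \<in> borel_measurable M"
  using measurable_Pair2[OF measurable_joint, of p] by simp

lemma integrable_square_value: "integrable M (\<lambda>\<omega>. (Y p \<omega>)\<^sup>2)"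
  using unit_variance[of p] not_integrable_integral_eq by fastforce

lemma integrable_value: "integrable M (Y p)" and mean_value: "expectation (Y p) = 0"
  using centered by (auto simp: centered_field_def)

lemma integrable_mult_value: "integrable M (\<lambda>\<omega>. Y p \<omega> * Y q \<omega>)"
  by (rule integrable_mult_square[OF _ _ integrable_square_value integrable_square_value]) auto

lemma
  fixes c :: "'i \<Rightarrow> real"
  assumes "finite I"
  defines "L \<equiv> \<lambda>\<omega>. \<Sum>i\<in>I. c i * Y i \<omega>"
  shows integrable_square_linear_combination: "integrable M (\<lambda>\<omega>. (L \<omega>)\<^sup>2)"
    and char_linear_combination:
      "char (distr M borel L) s = exp (- (s\<^sup>2 * expectation (\<lambda>\<omega>. (L \<omega>)\<^sup>2)) / 2)"
proof -
  have L: "gaussian_rv M L"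
    using gaussian assms by (simp add: gaussian_field_def)
  have mean: "expectation L = 0"
    by (simp add: L_def integrable_value mean_value)
  show "integrable M (\<lambda>\<omega>. (L \<omega>)\<^sup>2)"
    by (rule integrable_square_gaussian_rv[OF L mean])
  show "char (distr M borel L) s = exp (- (s\<^sup>2 * expectation (\<lambda>\<omega>. (L \<omega>)\<^sup>2)) / 2)"
    by (rule char_gaussian_rv[OF L mean])
qed

lemma distr_value: "distr M borel (Y p) = std_normal_distribution"
proof (rule Levy_uniqueness)
  show "char (distr M borel (Y p)) = char std_normal_distribution"
    using char_linear_combination[of "{p}" "\<lambda>_. 1"]
    by (auto simp: char_std_normal_distribution unit_variance)
qed (auto simp: real_dist_normal_dist)

lemma abs_correlation_le: "\<bar>correlation p q\<bar> \<le> 1"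
proof -
  have "(correlation p q)\<^sup>2 \<le> 1"
    using Cauchy_Schwarz_integral[of "Y p" M "Y q"] by (simp add: integrable_square_value unit_variance)
  then show ?thesis by (simp add: abs_square_le_1)
qed

lemma
  fixes R :: "real \<Rightarrow> real"
  assumes [measurable]: "R \<in> borel_measurable borel"
    and sq: "integrable std_normal_distribution (\<lambda>x. (R x)\<^sup>2)"
  shows integrable_square_subordinated: "integrable M (\<lambda>\<omega>. (R (Y p \<omega>))\<^sup>2)"
    and expectation_square_subordinated: "expectation (\<lambda>\<omega>. (R (Y p \<omega>))\<^sup>2) = (LINT x|std_normal_distribution. (R x)\<^sup>2)"
proof -
  show "integrable M (\<lambda>\<omega>. (R (Y p \<omega>))\<^sup>2)"
    using sq integrable_distr[of "Y p" M borel "\<lambda>x. (R x)\<^sup>2"] by (simp add: distr_value)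
  show "expectation (\<lambda>\<omega>. (R (Y p \<omega>))\<^sup>2) = (LINT x|std_normal_distribution. (R x)\<^sup>2)"
    using integral_distr[of "Y p" M borel "\<lambda>x. (R x)\<^sup>2"] by (simp add: distr_value)
qed

text \<open>
  Only linear combinations of the field are known to be normal. The joint law of two values is
  recovered from them by subtracting from the second value its regression on the first: the
  characteristic function of the resulting pair factorises.
\<close>

lemma pair_law_decorrelated:
  assumes less: "(correlation p q)\<^sup>2 < 1"
  defines "\<rho> \<equiv> correlation p q"
  shows "distr M (borel \<Otimes>\<^sub>M borel) (\<lambda>\<omega>. (Y p \<omega>, (Y q \<omega> - \<rho> * Y p \<omega>) / sqrt (1 - \<rho>\<^sup>2)))
    = std_normal_distribution \<Otimes>\<^sub>M std_normal_distribution"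
proof -
  define \<sigma> where "\<sigma> = sqrt (1 - \<rho>\<^sup>2)"
  have \<sigma>: "\<sigma> > 0" "\<sigma>\<^sup>2 = 1 - \<rho>\<^sup>2" using less by (auto simp: \<sigma>_def \<rho>_def)
  define V where "V \<omega> = (Y q \<omega> - \<rho> * Y p \<omega>) / \<sigma>" for \<omega>
  have [measurable]: "V \<in> borel_measurable M" unfolding V_def[abs_def] by simp
  have "p \<noteq> q"
    using less unit_variance[of p] by (auto simp: power2_eq_square)
  \<comment> \<open>Subtracting the regression leaves a variable uncorrelated with \<open>Y p\<close>, and dividing by \<open>\<sigma>\<close> makes
      its variance \<open>1\<close>.\<close>
  have joint: "(CLINT \<omega>|M. iexp (s * Y p \<omega> + t * V \<omega>)) = exp (- (s\<^sup>2 + t\<^sup>2) / 2)" for s t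
  proof -
    \<comment> \<open>The coefficients of \<open>Y p\<close> and \<open>Y q\<close> in \<open>s Y p + t V\<close>.\<close>
    define c where "c i = (if i = p then s - t * \<rho> / \<sigma> else t / \<sigma>)" for i
    have L: "(\<Sum>i\<in>{p, q}. c i * Y i \<omega>) = s * Y p \<omega> + t * V \<omega>" for \<omega>
      using \<open>p \<noteq> q\<close> \<sigma> by (simp add: c_def V_def field_simps)
    have L': "s * Y p \<omega> + t * V \<omega> = c p * Y p \<omega> + c q * Y q \<omega>" for \<omega>
      using L[of \<omega>] \<open>p \<noteq> q\<close> by simp
    have "expectation (\<lambda>\<omega>. (s * Y p \<omega> + t * V \<omega>)\<^sup>2) =
        expectation (\<lambda>\<omega>. (c p)\<^sup>2 * (Y p \<omega>)\<^sup>2 + 2 * c p * c q * (Y p \<omega> * Y q \<omega>) + (c q)\<^sup>2 * (Y q \<omega>)\<^sup>2)"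
      unfolding L' by (intro Bochner_Integration.integral_cong) (auto simp: power2_eq_square algebra_simps)
    also have "\<dots> = (c p)\<^sup>2 + 2 * c p * c q * \<rho> + (c q)\<^sup>2"
      by (simp add: integrable_square_value integrable_mult_value unit_variance \<rho>_def)
    also have "\<dots> = s\<^sup>2 + t\<^sup>2"
    proof -
      have "(c p)\<^sup>2 + 2 * c p * c q * \<rho> + (c q)\<^sup>2 = s\<^sup>2 + (t / \<sigma>)\<^sup>2 * (1 - \<rho>\<^sup>2)"
        using \<open>p \<noteq> q\<close> by (simp add: c_def power2_eq_square algebra_simps diff_divide_distrib)
      also have "\<dots> = s\<^sup>2 + t\<^sup>2"
        using \<sigma>(1) unfolding \<sigma>(2)[symmetric] by (simp add: power_divide)
      finally show ?thesis .
    qed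
    finally show ?thesis
      using char_linear_combination[of "{p, q}" c 1] by (simp only: L) (simp add: char_distr)
  qed
  have X: "(CLINT \<omega>|M. iexp (s * Y p \<omega>)) = exp (- s\<^sup>2 / 2)" for s
    using joint[of s 0] by simp
  have V: "(CLINT \<omega>|M. iexp (t * V \<omega>)) = exp (- t\<^sup>2 / 2)" for t
    using joint[of 0 t] by simp
  have "distr M (borel \<Otimes>\<^sub>M borel) (\<lambda>\<omega>. (Y p \<omega>, V \<omega>)) = distr M borel (Y p) \<Otimes>\<^sub>M distr M borel V"
  proof (rule pair_law_eqI)
    show "(CLINT \<omega>|M. iexp (s * Y p \<omega> + t * V \<omega>)) = (CLINT \<omega>|M. iexp (s * Y p \<omega>)) * (CLINT \<omega>|M. iexp (t * V \<omega>))" for s t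
      unfolding joint X V by (simp add: diff_divide_distrib exp_add[symmetric] flip: exp_of_real)
  qed auto
  also have "distr M borel V = std_normal_distribution"
  proof (rule Levy_uniqueness)
    show "char (distr M borel V) = char std_normal_distribution"
      using V by (auto simp: char_std_normal_distribution char_distr)
  qed (auto simp: real_dist_normal_dist)
  finally show ?thesis
    by (simp add: distr_value V_def \<sigma>_def)
qed

text \<open>
  For \<open>\<rho>\<^sup>2 \<le> 1/2\<close> the kernel estimate applies, with \<open>1 / (1 - \<rho>\<^sup>2) \<le> 2\<close>; otherwise, in particular for
  coinciding points, the Cauchy-Schwarz inequality suffices because then \<open>2 \<rho>\<^sup>2 > 1\<close>.
\<close>

lemma rank_two_covariance_bound:
  fixes R :: "real \<Rightarrow> real"
  assumes [measurable]: "R \<in> borel_measurable borel"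
    and sq: "integrable std_normal_distribution (\<lambda>x. (R x)\<^sup>2)"
    and orth0: "(LINT x|std_normal_distribution. R x) = 0"
    and orth1: "(LINT x|std_normal_distribution. x * R x) = 0"
  shows "\<bar>expectation (\<lambda>\<omega>. R (Y p \<omega>) * R (Y q \<omega>))\<bar>
    \<le> 2 * (LINT x|std_normal_distribution. (R x)\<^sup>2) * (correlation p q)\<^sup>2"
proof -
  define \<rho> where "\<rho> = correlation p q"
  define A where "A = (LINT x|std_normal_distribution. (R x)\<^sup>2)"
  have "A \<ge> 0" by (simp add: A_def)
  note R2 = integrable_square_subordinated[OF assms(1) sq]
  have "(expectation (\<lambda>\<omega>. R (Y p \<omega>) * R (Y q \<omega>)))\<^sup>2 \<le> (2 * A * \<rho>\<^sup>2)\<^sup>2"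
  proof (cases "\<rho>\<^sup>2 \<le> 1 / 2")
    case True
    then have less: "\<rho>\<^sup>2 < 1" by simp
    have "(expectation (\<lambda>\<omega>. R (Y p \<omega>) * R (Y q \<omega>)))\<^sup>2 \<le> A\<^sup>2 * (\<rho>^4 / (1 - \<rho>\<^sup>2))"
      unfolding A_def
    proof (rule correlated_std_normal_integral_bound[OF _ _ assms(1)])
      show "distr M (borel \<Otimes>\<^sub>M borel) (\<lambda>\<omega>. (Y p \<omega>, (Y q \<omega> - \<rho> * Y p \<omega>) / sqrt (1 - \<rho>\<^sup>2)))
        = std_normal_distribution \<Otimes>\<^sub>M std_normal_distribution"
        using pair_law_decorrelated[of p q] less by (simp add: \<rho>_def)
      show "Y q \<omega> = \<rho> * Y p \<omega> + sqrt (1 - \<rho>\<^sup>2) * ((Y q \<omega> - \<rho> * Y p \<omega>) / sqrt (1 - \<rho>\<^sup>2))" for \<omega>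
        using less by simp
    qed (use less R2 sq orth0 orth1 in auto)
    also have "\<rho>^4 / (1 - \<rho>\<^sup>2) \<le> \<rho>^4 / (1 / 2)"
      using True by (intro divide_left_mono) auto
    also have "A\<^sup>2 * (\<rho>^4 / (1 / 2)) \<le> 2 * (A\<^sup>2 * (\<rho>^4 / (1 / 2)))"
      by simp
    also have "\<dots> = (2 * A * \<rho>\<^sup>2)\<^sup>2"
      by (simp add: power_mult_distrib flip: power_mult)
    finally show ?thesis by (simp add: mult_left_mono)
  next
    case False
    have "(expectation (\<lambda>\<omega>. R (Y p \<omega>) * R (Y q \<omega>)))\<^sup>2 \<le> A * A"
      using Cauchy_Schwarz_integral[of "\<lambda>\<omega>. R (Y p \<omega>)" M "\<lambda>\<omega>. R (Y q \<omega>)"] R2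
      by (simp add: expectation_square_subordinated[OF assms(1) sq] A_def)
    also have "\<dots> = (A * 1)\<^sup>2"
      by (simp add: power2_eq_square)
    also have "\<dots> \<le> (A * (2 * \<rho>\<^sup>2))\<^sup>2"
      using \<open>A \<ge> 0\<close> False by (intro power_mono mult_left_mono) auto
    finally show ?thesis by (simp add: mult_ac)
  qed
  then have "\<bar>expectation (\<lambda>\<omega>. R (Y p \<omega>) * R (Y q \<omega>))\<bar> \<le> \<bar>2 * A * \<rho>\<^sup>2\<bar>"
    by (simp add: abs_le_square_iff)
  then show ?thesis
    using \<open>A \<ge> 0\<close> by (simp add: A_def \<rho>_def)
qed

end

locale averaged_gaussian_field = standard_gaussian_field M Y + N: prob_space N
  for M :: "'w measure" and Y :: "'i::topological_space \<Rightarrow> 'w \<Rightarrow> real" and N :: "'i measure" +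
  assumes sets_N [measurable_cong]: "sets N = sets borel"
begin

sublocale NM: pair_prob_space N M ..

lemma measurable_joint_N [measurable]: "(\<lambda>(p, \<omega>). Y p \<omega>) \<in> borel_measurable (N \<Otimes>\<^sub>M M)"
  using measurable_joint by (simp cong: measurable_cong_sets)

abbreviation average :: "'w \<Rightarrow> real" where
  "average \<omega> \<equiv> LINT p|N. Y p \<omega>"

lemma measurable_average_value [measurable]: "average \<in> borel_measurable M"
  and AE_integrable_average_value: "AE \<omega> in M. integrable N (\<lambda>p. Y p \<omega>)"
  and integrable_square_average_value: "integrable M (\<lambda>\<omega>. (average \<omega>)\<^sup>2)"
  using NM.measurable_average[OF measurable_joint_N integrable_square_value, of 1]
    NM.AE_integrable_average[OF measurable_joint_N integrable_square_value, of 1]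
    NM.integrable_square_average[OF measurable_joint_N integrable_square_value, of 1]
  by (auto simp: unit_variance)

text \<open>
  A derandomised law of large numbers. If the points \<open>p\<^sub>1, p\<^sub>2, \<dots>\<close> were drawn independently from \<open>N\<close>,
  the deviation of \<open>Y p\<^sub>1 + \<dots> + Y p\<^sub>k\<close> from \<open>k\<close> times the average would have second moment at most
  \<open>k\<close>. The points can be chosen one after the other: on average over the next point \<open>p\<close> the cross
  term with the current deviation vanishes and the second moment grows by at most \<open>1\<close>, so that
  some \<open>p\<close> does at least as well. A point may be picked several times, which is why the statement
  is about a linear combination with coefficients.
\<close>

lemma linear_combination_near_average:
  "\<exists>I c. finite I \<and> expectation (\<lambda>\<omega>. ((\<Sum>i\<in>I. c i * Y i \<omega>) - real k * average \<omega>)\<^sup>2) \<le> real k"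
proof (induction k)
  case 0
  show ?case by (rule exI[of _ "{}"]) simp
next
  case (Suc k)
  then obtain I c where I: "finite I"
    and le: "expectation (\<lambda>\<omega>. ((\<Sum>i\<in>I. c i * Y i \<omega>) - real k * average \<omega>)\<^sup>2) \<le> real k"
    by auto
  define S where "S \<omega> = (\<Sum>i\<in>I. c i * Y i \<omega>) - real k * average \<omega>" for \<omega>
  have [measurable]: "S \<in> borel_measurable M"
    unfolding S_def[abs_def] by measurable
  have S2: "integrable M (\<lambda>\<omega>. (S \<omega>)\<^sup>2)"
    unfolding S_def
    by (rule integrable_diff_square[OF _ _ integrable_square_linear_combination[OF I]])
       (auto simp: power_mult_distrib integrable_square_average_value)
  note Z2 = integrable_square_average_value
  note avg = NM.integrable_expectation_mult[OF measurable_joint_N integrable_square_value, of 1]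
    NM.expectation_mult_average[OF measurable_joint_N integrable_square_value, of 1]
  have SY: "integrable N (\<lambda>p. expectation (\<lambda>\<omega>. S \<omega> * Y p \<omega>))"
    "(LINT p|N. expectation (\<lambda>\<omega>. S \<omega> * Y p \<omega>)) = expectation (\<lambda>\<omega>. S \<omega> * average \<omega>)"
    using avg(1)[of S] avg(2)[of S] S2 by (auto simp: unit_variance)
  have ZY: "integrable N (\<lambda>p. expectation (\<lambda>\<omega>. average \<omega> * Y p \<omega>))"
    "(LINT p|N. expectation (\<lambda>\<omega>. average \<omega> * Y p \<omega>)) = expectation (\<lambda>\<omega>. average \<omega> * average \<omega>)"
    using avg(1)[of average] avg(2)[of average] Z2 by (auto simp: unit_variance)
  \<comment> \<open>The second moment after the choice of \<open>p\<close> as the next point.\<close>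
  define \<phi> where "\<phi> p = expectation (\<lambda>\<omega>. (S \<omega> + (Y p \<omega> - average \<omega>))\<^sup>2)" for p
  have \<phi>: "\<phi> p = expectation (\<lambda>\<omega>. (S \<omega>)\<^sup>2) + 2 * expectation (\<lambda>\<omega>. S \<omega> * Y p \<omega>)
      - 2 * expectation (\<lambda>\<omega>. S \<omega> * average \<omega>) + 1 - 2 * expectation (\<lambda>\<omega>. average \<omega> * Y p \<omega>)
      + expectation (\<lambda>\<omega>. (average \<omega>)\<^sup>2)" for p
  proof -
    have "\<phi> p = expectation (\<lambda>\<omega>. (S \<omega>)\<^sup>2 + 2 * (S \<omega> * Y p \<omega>) - 2 * (S \<omega> * average \<omega>)
        + (Y p \<omega>)\<^sup>2 - 2 * (average \<omega> * Y p \<omega>) + (average \<omega>)\<^sup>2)"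
      unfolding \<phi>_def by (intro Bochner_Integration.integral_cong) (auto simp: power2_eq_square algebra_simps)
    moreover have "integrable M (\<lambda>\<omega>. S \<omega> * Y p \<omega>)" "integrable M (\<lambda>\<omega>. S \<omega> * average \<omega>)"
      "integrable M (\<lambda>\<omega>. average \<omega> * Y p \<omega>)"
      by (rule integrable_mult_square; simp add: S2 Z2 integrable_square_value)+
    ultimately show ?thesis
      using S2 Z2 integrable_square_value[of p] by (simp add: unit_variance)
  qed
  have int_\<phi>: "integrable N \<phi>"
    unfolding \<phi>[abs_def] using SY(1) ZY(1) by simp
  have "(LINT p|N. \<phi> p) = expectation (\<lambda>\<omega>. (S \<omega>)\<^sup>2) + 1 - expectation (\<lambda>\<omega>. (average \<omega>)\<^sup>2)"
    unfolding \<phi> using SY ZY N.prob_space by (simp add: power2_eq_square)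
  also have "\<dots> \<le> real k + 1"
  proof -
    have "0 \<le> expectation (\<lambda>\<omega>. (average \<omega>)\<^sup>2)" by simp
    then show ?thesis using le unfolding S_def by linarith
  qed
  finally have "\<not> (real k + 1 < N.expectation \<phi>)" by simp
  then have "\<not> (AE p in N. real k + 1 < \<phi> p)"
    using N.expectation_greater[OF int_\<phi>] by blast
  then have "\<not> (\<forall>p. real k + 1 < \<phi> p)"
    by (auto intro: AE_I2)
  then obtain p where p: "\<phi> p \<le> real k + 1"
    by (auto simp: not_less)
  define c' where "c' i = (if i \<in> I then c i else 0) + (if i = p then 1 else 0)" for i
  have "(\<Sum>i\<in>insert p I. c' i * Y i \<omega>) = (\<Sum>i\<in>I. c i * Y i \<omega>) + Y p \<omega>" for \<omega>
  proof -
    have "(\<Sum>i\<in>insert p I. c' i * Y i \<omega>) = (\<Sum>i\<in>insert p I. (if i \<in> I then c i * Y i \<omega> else 0))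
        + (\<Sum>i\<in>insert p I. (if i = p then Y i \<omega> else 0))"
      unfolding sum.distrib[symmetric] by (rule sum.cong) (auto simp: c'_def algebra_simps)
    moreover have "(\<Sum>i\<in>insert p I. (if i = p then Y i \<omega> else 0)) = Y p \<omega>"
      using I by (simp add: sum.delta)
    moreover have "(\<Sum>i\<in>insert p I. (if i \<in> I then c i * Y i \<omega> else 0)) = (\<Sum>i\<in>I. c i * Y i \<omega>)"
      using I by (intro sum.mono_neutral_cong_right) auto
    ultimately show ?thesis by simp
  qed
  then have "(\<Sum>i\<in>insert p I. c' i * Y i \<omega>) - real (Suc k) * average \<omega> = S \<omega> + (Y p \<omega> - average \<omega>)" for \<omega>
    by (simp add: S_def algebra_simps)
  then have "expectation (\<lambda>\<omega>. ((\<Sum>i\<in>insert p I. c' i * Y i \<omega>) - real (Suc k) * average \<omega>)\<^sup>2) \<le> real (Suc k)"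
    using p by (simp only: \<phi>_def)
  then show ?case using I by (intro exI[of _ "insert p I"] exI[of _ c']) simp
qed

text \<open>
  The average of a Gaussian field is Gaussian even if the paths are merely measurable: it is the
  mean-square limit of finite linear combinations. Riemann sums need not converge here.
\<close>

lemma char_average:
  "char (distr M borel average) s = exp (- (s\<^sup>2 * expectation (\<lambda>\<omega>. (average \<omega>)\<^sup>2)) / 2)"
proof -
  have "\<exists>J d. finite J \<and> expectation (\<lambda>\<omega>. ((\<Sum>i\<in>J. d i * Y i \<omega>) - average \<omega>)\<^sup>2) \<le> 1 / real (Suc k)" for k
  proof -
    obtain I c where I: "finite I"
      and le: "expectation (\<lambda>\<omega>. ((\<Sum>i\<in>I. c i * Y i \<omega>) - real (Suc k) * average \<omega>)\<^sup>2) \<le> real (Suc k)"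
      using linear_combination_near_average[of "Suc k"] by blast
    have "((\<Sum>i\<in>I. (c i / real (Suc k)) * Y i \<omega>) - average \<omega>)\<^sup>2
        = ((\<Sum>i\<in>I. c i * Y i \<omega>) - real (Suc k) * average \<omega>)\<^sup>2 / (real (Suc k))\<^sup>2" for \<omega>
    proof -
      have "(\<Sum>i\<in>I. (c i / real (Suc k)) * Y i \<omega>) - average \<omega>
        = ((\<Sum>i\<in>I. c i * Y i \<omega>) - real (Suc k) * average \<omega>) / real (Suc k)"
        by (simp add: sum_divide_distrib diff_divide_distrib del: of_nat_Suc)
      then show ?thesis by (simp only: power_divide)
    qed
    then have "expectation (\<lambda>\<omega>. ((\<Sum>i\<in>I. (c i / real (Suc k)) * Y i \<omega>) - average \<omega>)\<^sup>2)
        = expectation (\<lambda>\<omega>. ((\<Sum>i\<in>I. c i * Y i \<omega>) - real (Suc k) * average \<omega>)\<^sup>2) / (real (Suc k))\<^sup>2"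
      by simp
    also have "\<dots> \<le> real (Suc k) / (real (Suc k))\<^sup>2"
      by (rule divide_right_mono[OF le]) simp
    also have "\<dots> = 1 / real (Suc k)"
      by (simp add: power2_eq_square)
    finally show ?thesis
      by (intro exI[of _ I] exI[of _ "\<lambda>i. c i / real (Suc k)"] conjI I)
  qed
  then have "\<forall>k. \<exists>J d. finite J \<and> expectation (\<lambda>\<omega>. ((\<Sum>i\<in>J. d i * Y i \<omega>) - average \<omega>)\<^sup>2) \<le> 1 / real (Suc k)"
    by (rule allI)
  from choice[OF this] obtain J where
    "\<forall>k. \<exists>d. finite (J k) \<and> expectation (\<lambda>\<omega>. ((\<Sum>i\<in>J k. d i * Y i \<omega>) - average \<omega>)\<^sup>2) \<le> 1 / real (Suc k)" ..
  from choice[OF this] obtain d where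
    Jd: "\<forall>k. finite (J k) \<and> expectation (\<lambda>\<omega>. ((\<Sum>i\<in>J k. d k i * Y i \<omega>) - average \<omega>)\<^sup>2) \<le> 1 / real (Suc k)" ..
  have J: "finite (J k)" for k
    using Jd[THEN spec, of k] by (rule conjunct1)
  have near: "expectation (\<lambda>\<omega>. ((\<Sum>i\<in>J k. d k i * Y i \<omega>) - average \<omega>)\<^sup>2) \<le> 1 / real (Suc k)" for k
    using Jd[THEN spec, of k] by (rule conjunct2)
  define L where "L k \<omega> = (\<Sum>i\<in>J k. d k i * Y i \<omega>)" for k \<omega>
  have [measurable]: "L k \<in> borel_measurable M" for k
    unfolding L_def[abs_def] by measurable
  have L2: "integrable M (\<lambda>\<omega>. (L k \<omega>)\<^sup>2)" for k
    unfolding L_def by (rule integrable_square_linear_combination[OF J])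
  have D2: "integrable M (\<lambda>\<omega>. (L k \<omega> - average \<omega>)\<^sup>2)" for k
    by (rule integrable_diff_square) (auto simp: L2 integrable_square_average_value)
  define e where "e k = expectation (\<lambda>\<omega>. (L k \<omega> - average \<omega>)\<^sup>2)" for k
  have e: "e \<longlonglongrightarrow> 0"
  proof (rule tendsto_sandwich[OF _ _ tendsto_const LIMSEQ_inverse_real_of_nat])
    show "\<forall>\<^sub>F k in sequentially. e k \<le> inverse (real (Suc k))"
      using near by (simp add: e_def L_def inverse_eq_divide)
  qed (simp add: e_def)
  define v where "v = expectation (\<lambda>\<omega>. (average \<omega>)\<^sup>2)"
  have var: "(\<lambda>k. expectation (\<lambda>\<omega>. (L k \<omega>)\<^sup>2)) \<longlonglongrightarrow> v"
  proof -
    define m where "m k = expectation (\<lambda>\<omega>. average \<omega> * (L k \<omega> - average \<omega>))" for k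
    have m: "m \<longlonglongrightarrow> 0"
    proof (rule Lim_null_comparison)
      have "(m k)\<^sup>2 \<le> v * e k" for k
        unfolding m_def v_def e_def by (rule Cauchy_Schwarz_integral) (auto simp: D2 integrable_square_average_value)
      then have "\<bar>m k\<bar> \<le> sqrt (v * e k)" for k
        by (simp add: real_le_rsqrt)
      then show "\<forall>\<^sub>F k in sequentially. norm (m k) \<le> sqrt (v * e k)" by simp
      show "(\<lambda>k. sqrt (v * e k)) \<longlonglongrightarrow> 0"
        using tendsto_real_sqrt[OF tendsto_mult_left[OF e, of v]] by simp
    qed
    have "expectation (\<lambda>\<omega>. (L k \<omega>)\<^sup>2) = v + 2 * m k + e k" for k
    proof -
      have "integrable M (\<lambda>\<omega>. average \<omega> * (L k \<omega> - average \<omega>))"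
        by (rule integrable_mult_square) (auto simp: D2 integrable_square_average_value)
      then have "expectation (\<lambda>\<omega>. (average \<omega>)\<^sup>2 + 2 * (average \<omega> * (L k \<omega> - average \<omega>)) + (L k \<omega> - average \<omega>)\<^sup>2)
          = v + 2 * m k + e k"
        unfolding v_def m_def e_def using D2[of k] integrable_square_average_value by simp
      moreover have "(L k \<omega>)\<^sup>2 = (average \<omega>)\<^sup>2 + 2 * (average \<omega> * (L k \<omega> - average \<omega>)) + (L k \<omega> - average \<omega>)\<^sup>2" for \<omega>
        by (simp add: power2_eq_square algebra_simps)
      ultimately show ?thesis by simp
    qed
    moreover have "(\<lambda>k. v + 2 * m k + e k) \<longlonglongrightarrow> v + 2 * 0 + 0"
      by (intro tendsto_intros m e)
    ultimately show ?thesis by simp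
  qed
  have "(\<lambda>k. char (distr M borel (L k)) s) \<longlonglongrightarrow> exp (- (s\<^sup>2 * v) / 2)"
  proof -
    have "char (distr M borel (L k)) s = exp (- (s\<^sup>2 * expectation (\<lambda>\<omega>. (L k \<omega>)\<^sup>2)) / 2)" for k
      unfolding L_def using char_linear_combination[OF J] by simp
    moreover have "(\<lambda>k. exp (- (s\<^sup>2 * expectation (\<lambda>\<omega>. (L k \<omega>)\<^sup>2)) / 2)) \<longlonglongrightarrow> exp (- (s\<^sup>2 * v) / 2)"
      by (intro tendsto_intros var) simp
    ultimately show ?thesis
      using tendsto_of_real by fastforce
  qed
  moreover have "(\<lambda>k. char (distr M borel (L k)) s) \<longlonglongrightarrow> char (distr M borel average) s"
  proof (rule Lim_transform2[OF tendsto_const], rule Lim_null_comparison)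
    show "\<forall>\<^sub>F k in sequentially. norm (char (distr M borel average) s - char (distr M borel (L k)) s) \<le> \<bar>s\<bar> * sqrt (e k)"
      using norm_char_diff_le[of "L _" average s] D2 by (simp add: e_def norm_minus_commute)
    show "(\<lambda>k. \<bar>s\<bar> * sqrt (e k)) \<longlonglongrightarrow> 0"
      using tendsto_mult_left[OF tendsto_real_sqrt[OF e], of "\<bar>s\<bar>"] by simp
  qed
  ultimately show ?thesis
    unfolding v_def by (rule LIMSEQ_unique[symmetric])
qed

lemma expectation_square_average_value:
  "expectation (\<lambda>\<omega>. (average \<omega>)\<^sup>2) = (LINT p|N. LINT q|N. correlation p q)"
  using NM.expectation_square_average(1)[OF measurable_joint_N measurable_value integrable_square_value, of 1]
  by (simp add: unit_variance)

lemma average_rank_two_bound: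
  fixes R :: "real \<Rightarrow> real"
  assumes [measurable]: "R \<in> borel_measurable borel"
    and sq: "integrable std_normal_distribution (\<lambda>x. (R x)\<^sup>2)"
    and orth0: "(LINT x|std_normal_distribution. R x) = 0"
    and orth1: "(LINT x|std_normal_distribution. x * R x) = 0"
  shows "AE \<omega> in M. integrable N (\<lambda>p. R (Y p \<omega>))"
    and "integrable M (\<lambda>\<omega>. (LINT p|N. R (Y p \<omega>))\<^sup>2)"
    and "expectation (\<lambda>\<omega>. (LINT p|N. R (Y p \<omega>))\<^sup>2)
      \<le> 2 * (LINT x|std_normal_distribution. (R x)\<^sup>2) * (LINT p|N. LINT q|N. (correlation p q)\<^sup>2)"
proof -
  define A where "A = (LINT x|std_normal_distribution. (R x)\<^sup>2)"
  have RY [measurable]: "(\<lambda>(p, \<omega>). R (Y p \<omega>)) \<in> borel_measurable (N \<Otimes>\<^sub>M M)"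
    by measurable
  have RM: "(\<lambda>\<omega>. R (Y p \<omega>)) \<in> borel_measurable M" for p by measurable
  note sub = integrable_square_subordinated[OF assms(1) sq]
    expectation_square_subordinated[OF assms(1) sq, THEN eq_refl]
  show "AE \<omega> in M. integrable N (\<lambda>p. R (Y p \<omega>))"
    by (rule NM.AE_integrable_average[OF RY sub])
  show "integrable M (\<lambda>\<omega>. (LINT p|N. R (Y p \<omega>))\<^sup>2)"
    by (rule NM.integrable_square_average[OF RY sub])
  have KN: "(\<lambda>(p, q). correlation p q) \<in> borel_measurable (N \<Otimes>\<^sub>M N)"
    by measurable
  have K2: "(correlation p q)\<^sup>2 \<le> 1" for p q
    using abs_correlation_le[of p q] by (simp add: abs_square_le_1)
  have inner: "integrable N (\<lambda>q. (correlation p q)\<^sup>2)" for p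
    using KN K2 by (intro N.integrable_const_bound[of _ 1]) (auto intro!: borel_measurable_power measurable_Pair2[OF KN, simplified])
  have outer: "integrable N (\<lambda>p. LINT q|N. (correlation p q)\<^sup>2)"
  proof (rule N.integrable_const_bound[of _ 1])
    have "(\<lambda>(p, q). (correlation p q)\<^sup>2) \<in> borel_measurable (N \<Otimes>\<^sub>M N)"
      using KN by (auto simp: case_prod_beta' intro: borel_measurable_power)
    then show "(\<lambda>p. LINT q|N. (correlation p q)\<^sup>2) \<in> borel_measurable N"
      by (rule N.borel_measurable_lebesgue_integral)
    have "(LINT q|N. (correlation p q)\<^sup>2) \<le> (LINT q|N. 1)" for p
      by (intro integral_mono inner K2) simp
    then show "AE p in N. norm (LINT q|N. (correlation p q)\<^sup>2) \<le> 1"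
      using N.prob_space by simp
  qed
  have "expectation (\<lambda>\<omega>. (LINT p|N. R (Y p \<omega>))\<^sup>2)
      = (LINT p|N. LINT q|N. expectation (\<lambda>\<omega>. R (Y p \<omega>) * R (Y q \<omega>)))"
    by (rule NM.expectation_square_average(1)[OF RY RM sub])
  also have "\<dots> \<le> (LINT p|N. LINT q|N. 2 * A * (correlation p q)\<^sup>2)"
  proof (intro integral_mono)
    show "integrable N (\<lambda>p. LINT q|N. expectation (\<lambda>\<omega>. R (Y p \<omega>) * R (Y q \<omega>)))"
      by (rule NM.expectation_square_average(3)[OF RY RM sub])
    show "integrable N (\<lambda>q. expectation (\<lambda>\<omega>. R (Y p \<omega>) * R (Y q \<omega>)))" for p
      by (rule NM.expectation_square_average(2)[OF RY RM sub])
    show "expectation (\<lambda>\<omega>. R (Y p \<omega>) * R (Y q \<omega>)) \<le> 2 * A * (correlation p q)\<^sup>2" for p q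
      unfolding A_def using rank_two_covariance_bound[OF assms, of p q] by linarith
  qed (use inner outer in auto)
  also have "\<dots> = 2 * A * (LINT p|N. LINT q|N. (correlation p q)\<^sup>2)"
    by simp
  finally show "expectation (\<lambda>\<omega>. (LINT p|N. R (Y p \<omega>))\<^sup>2)
      \<le> 2 * (LINT x|std_normal_distribution. (R x)\<^sup>2) * (LINT p|N. LINT q|N. (correlation p q)\<^sup>2)"
    by (simp add: A_def)
qed

text \<open>
  The function \<open>g\<close> splits into \<open>c0 + c1 x\<close> and a remainder orthogonal to \<open>1\<close> and \<open>x\<close>. The linear part
  averages to an exact Gaussian variable, and the remainder enters only through its second moment.
\<close>

lemma char_subordinated_average:
  fixes g :: "real \<Rightarrow> real" and w s :: real
  assumes [measurable]: "g \<in> borel_measurable borel" and g_le: "\<And>x. \<bar>g x\<bar> \<le> 1"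
  defines "c0 \<equiv> LINT x|std_normal_distribution. g x"
    and "c1 \<equiv> LINT x|std_normal_distribution. x * g x"
  defines "A \<equiv> LINT x|std_normal_distribution. (g x - c0 - c1 * x)\<^sup>2"
  shows "cmod (char (distr M borel (\<lambda>\<omega>. w * ((LINT p|N. g (Y p \<omega>)) - c0))) s
      - exp (- (s\<^sup>2 * ((w * c1)\<^sup>2 * (LINT p|N. LINT q|N. correlation p q))) / 2))
    \<le> \<bar>s\<bar> * sqrt (w\<^sup>2 * (2 * A * (LINT p|N. LINT q|N. (correlation p q)\<^sup>2)))"
proof -
  let ?S = "std_normal_distribution"
  define R where "R x = g x - c0 - c1 * x" for x
  have R_measurable [measurable]: "R \<in> borel_measurable borel"
    unfolding R_def[abs_def] by measurable
  have gI: "integrable ?S g"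
    using g_le by (intro std_normal.integrable_const_bound[of _ 1]) auto
  have g2: "integrable ?S (\<lambda>x. (g x)\<^sup>2)"
    using g_le by (intro std_normal.integrable_const_bound[of _ 1]) (auto simp: abs_square_le_1)
  have xg: "integrable ?S (\<lambda>x. x * g x)"
    by (rule integrable_mult_square[OF _ _ std_normal_moments(3) g2]) auto
  have R2: "integrable ?S (\<lambda>x. (R x)\<^sup>2)"
    unfolding R_def
  proof (rule integrable_diff_square)
    show "integrable ?S (\<lambda>x. (g x - c0)\<^sup>2)"
      by (rule integrable_diff_square[OF _ _ g2]) auto
    show "integrable ?S (\<lambda>x. (c1 * x)\<^sup>2)"
      unfolding power_mult_distrib by (rule integrable_mult_right) (rule std_normal_moments(3))
  qed auto
  have orth0: "(LINT x|?S. R x) = 0"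
  proof -
    have "(LINT x|?S. R x) = (LINT x|?S. g x) - (LINT x|?S. c0) - (LINT x|?S. c1 * x)"
      unfolding R_def using gI std_normal_moments(1) by simp
    then show ?thesis
      using std_normal_moments(2) std_normal.prob_space by (simp add: c0_def)
  qed
  have orth1: "(LINT x|?S. x * R x) = 0"
  proof -
    have "(LINT x|?S. x * R x) = (LINT x|?S. x * g x - c0 * x - c1 * x\<^sup>2)"
      by (intro Bochner_Integration.integral_cong) (auto simp: R_def power2_eq_square algebra_simps)
    also have "\<dots> = c1 - c0 * 0 - c1 * 1"
      using xg std_normal_moments(1,3) by (simp add: std_normal_moments(2,4) c1_def)
    finally show ?thesis by simp
  qed
  note bnd = average_rank_two_bound[OF R_measurable R2 orth0 orth1]
  define T where "T \<omega> = w * ((LINT p|N. g (Y p \<omega>)) - c0)" for \<omega>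
  have [measurable]: "T \<in> borel_measurable M"
    unfolding T_def[abs_def] by measurable
  define L where "L \<omega> = w * c1 * average \<omega>" for \<omega>
  have [measurable]: "L \<in> borel_measurable M"
    unfolding L_def[abs_def] by measurable
  have diff: "AE \<omega> in M. (T \<omega> - L \<omega>)\<^sup>2 = w\<^sup>2 * (LINT p|N. R (Y p \<omega>))\<^sup>2"
    using AE_integrable_average_value AE_space
  proof eventually_elim
    case (elim \<omega>)
    have [measurable]: "(\<lambda>p. Y p \<omega>) \<in> borel_measurable N"
      using elim by auto
    have "integrable N (\<lambda>p. g (Y p \<omega>))"
      using g_le by (intro N.integrable_const_bound[of _ 1]) auto
    then have "(LINT p|N. R (Y p \<omega>)) = (LINT p|N. g (Y p \<omega>)) - c0 - c1 * average \<omega>"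
      unfolding R_def using elim N.prob_space by simp
    then have "T \<omega> - L \<omega> = w * (LINT p|N. R (Y p \<omega>))"
      by (simp add: T_def L_def right_diff_distrib)
    then show ?case
      by (simp only: power_mult_distrib)
  qed
  have sqT: "integrable M (\<lambda>\<omega>. (T \<omega> - L \<omega>)\<^sup>2)"
    by (subst integrable_cong_AE[OF _ _ diff]) (auto intro!: integrable_mult_right bnd(2))
  have le: "expectation (\<lambda>\<omega>. (T \<omega> - L \<omega>)\<^sup>2) \<le> w\<^sup>2 * (2 * A * (LINT p|N. LINT q|N. (correlation p q)\<^sup>2))"
  proof -
    have "expectation (\<lambda>\<omega>. (T \<omega> - L \<omega>)\<^sup>2) = expectation (\<lambda>\<omega>. w\<^sup>2 * (LINT p|N. R (Y p \<omega>))\<^sup>2)"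
      by (rule integral_cong_AE[OF _ _ diff]) auto
    also have "\<dots> = w\<^sup>2 * expectation (\<lambda>\<omega>. (LINT p|N. R (Y p \<omega>))\<^sup>2)"
      by simp
    also have "\<dots> \<le> w\<^sup>2 * (2 * A * (LINT p|N. LINT q|N. (correlation p q)\<^sup>2))"
      using bnd(3) by (intro mult_left_mono) (auto simp: A_def R_def)
    finally show ?thesis .
  qed
  have charL: "char (distr M borel L) s = exp (- (s\<^sup>2 * ((w * c1)\<^sup>2 * (LINT p|N. LINT q|N. correlation p q))) / 2)"
  proof -
    have "char (distr M borel L) s = char (distr M borel average) (s * (w * c1))"
      by (simp add: char_distr L_def mult_ac)
    then show ?thesis
      by (simp add: char_average expectation_square_average_value power_mult_distrib mult.assoc)
  qed
  have "cmod (char (distr M borel T) s - char (distr M borel L) s)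
      \<le> \<bar>s\<bar> * sqrt (expectation (\<lambda>\<omega>. (T \<omega> - L \<omega>)\<^sup>2))"
    by (rule norm_char_diff_le) (use sqT in auto)
  also have "\<dots> \<le> \<bar>s\<bar> * sqrt (w\<^sup>2 * (2 * A * (LINT p|N. LINT q|N. (correlation p q)\<^sup>2)))"
    using le by (intro mult_left_mono) auto
  finally show ?thesis
    unfolding charL T_def .
qed

end

section \<open>Averages over space-time cylinders\<close>

lemma integrable_bounded_support:
  fixes F :: "'a \<Rightarrow> real"
  assumes [measurable]: "F \<in> borel_measurable M" "A \<in> sets M"
    and fin: "emeasure M A < \<infinity>"
    and bound: "\<And>x. \<bar>F x\<bar> \<le> B * indicator A x"
  shows "integrable M F"
proof (rule Bochner_Integration.integrable_bound)
  show "integrable M (\<lambda>x. B * indicator A x)"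
    using fin by (intro integrable_mult_right integrable_real_indicator) auto
  show "AE x in M. norm (F x) \<le> norm (B * indicator A x)"
    using bound by (intro AE_I2) (simp add: order_trans[OF _ abs_ge_self])
qed simp

lemma emeasure_cylinder:
  fixes U :: "'a::euclidean_space set" and a b :: real
  assumes [measurable]: "U \<in> sets borel" and U: "0 < measure lborel U" and ab: "a < b"
  shows "emeasure lborel (U \<times> {a<..<b}) = ennreal (measure lborel U * (b - a))"
proof -
  have finU: "emeasure lborel U \<noteq> \<infinity>"
    using U measure_zero_top[of lborel U] by auto
  have "emeasure lborel (U \<times> {a<..<b}) = emeasure lborel U * emeasure lborel {a<..<b}"
    unfolding lborel_prod[symmetric] by (intro lborel.emeasure_pair_measure_Times) auto
  also have "\<dots> = ennreal (measure lborel U * (b - a))"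
    using ab finU by (simp add: emeasure_eq_ennreal_measure ennreal_mult)
  finally show ?thesis .
qed

lemma prob_space_uniform_cylinder:
  fixes U :: "'a::euclidean_space set" and a b :: real
  assumes "U \<in> sets borel" and "0 < measure lborel U" and "a < b"
  shows "prob_space (uniform_measure lborel (U \<times> {a<..<b}))"
  by (rule prob_space_uniform_measure) (use assms in \<open>auto simp: emeasure_cylinder\<close>)

lemma integral_uniform_cylinder:
  fixes U :: "'a::euclidean_space set" and F :: "'a \<times> real \<Rightarrow> real"
  assumes [measurable]: "U \<in> sets borel" "F \<in> borel_measurable borel"
    and U: "0 < measure lborel U" and ab: "a < b"
    and bound: "\<And>p. \<bar>F p\<bar> \<le> B"
  shows "(LINT p|uniform_measure lborel (U \<times> {a<..<b}). F p)
    = (LINT t:{a<..<b}|lborel. LINT x:U|lborel. F (x, t)) / (measure lborel U * (b - a))"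
proof -
  define D where "D = U \<times> {a<..<b}"
  have [measurable]: "D \<in> sets borel"
    unfolding D_def borel_prod[symmetric] by measurable
  have D: "emeasure lborel D = ennreal (measure lborel U * (b - a))"
    unfolding D_def by (rule emeasure_cylinder[OF _ U ab]) simp
  define m where "m = measure lborel U * (b - a)"
  have m: "m > 0" using U ab by (simp add: m_def)
  have "uniform_measure lborel D = density lborel (\<lambda>p. ennreal (indicator D p / m))"
    unfolding uniform_measure_def D m_def[symmetric] using m
    by (intro density_cong) (auto simp: indicator_def divide_ennreal simp flip: ennreal_1)
  then have "(LINT p|uniform_measure lborel D. F p) = (LINT p|lborel. indicator D p / m * F p)"
    using m by (simp add: integral_density)
  also have "\<dots> = (LINT p|lborel. indicator D p * F p) / m"
    by simp
  also have "(LINT p|lborel. indicator D p * F p) = (LINT t|lborel. LINT x|lborel. indicator D (x, t) * F (x, t))"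
  proof -
    have "integrable lborel (\<lambda>p. indicator D p * F p)"
      by (rule integrable_bounded_support[of _ _ D B]) (use bound D in \<open>auto simp: indicator_def\<close>)
    then have "integrable (lborel \<Otimes>\<^sub>M lborel) (\<lambda>(x, t). indicator D (x, t) * F (x, t))"
      by (simp add: lborel_prod case_prod_beta')
    from lborel_pair.integral_snd[OF this] show ?thesis
      by (simp add: lborel_prod case_prod_beta')
  qed
  also have "\<dots> = (LINT t:{a<..<b}|lborel. LINT x:U|lborel. F (x, t))"
    unfolding set_lebesgue_integral_def
    by (intro Bochner_Integration.integral_cong refl)
       (auto simp: D_def indicator_times mult_ac simp flip: integral_mult_right_zero)
  finally show ?thesis by (simp add: D_def m_def)
qed

lemma abs_set_integral_le:
  fixes F :: "'a \<Rightarrow> real"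
  assumes [measurable]: "F \<in> borel_measurable M" "A \<in> sets M" and fin: "emeasure M A < \<infinity>"
    and bound: "\<And>x. \<bar>F x\<bar> \<le> B"
  shows "\<bar>LINT x:A|M. F x\<bar> \<le> B * measure M A"
proof -
  have "\<bar>LINT x:A|M. F x\<bar> \<le> (LINT x|M. B * indicator A x)"
    unfolding set_lebesgue_integral_def
  proof (rule order_trans[OF integral_abs_bound], rule integral_mono)
    show "integrable M (\<lambda>x. \<bar>indicator A x *\<^sub>R F x\<bar>)"
      using bound by (intro integrable_abs integrable_bounded_support[OF _ assms(2) fin, of _ B])
        (auto simp: indicator_def)
    show "integrable M (\<lambda>x. B * indicator A x)"
      using fin by (intro integrable_mult_right integrable_real_indicator) auto
  qed (use bound in \<open>auto simp: indicator_def\<close>)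
  then show ?thesis
    using sets.sets_into_space[OF assms(2)] by (simp add: Int_absorb2)
qed

lemma double_average_cylinder:
  fixes U :: "'a::euclidean_space set" and c :: "'a \<Rightarrow> 'a \<Rightarrow> real" and \<tau> :: "real \<Rightarrow> real"
  assumes [measurable]: "U \<in> sets borel" "\<tau> \<in> borel_measurable borel"
    and c [measurable]: "(\<lambda>(x, y). c x y) \<in> borel_measurable (borel \<Otimes>\<^sub>M borel)"
    and U: "0 < measure lborel U" and ab: "a < b"
    and c_le: "\<And>x y. \<bar>c x y\<bar> \<le> B" and \<tau>_le: "\<And>t. \<bar>\<tau> t\<bar> \<le> B'"
  defines "N \<equiv> uniform_measure lborel (U \<times> {a<..<b})"
  shows "(LINT p|N. LINT q|N. c (fst p) (fst q) * \<tau> \<bar>snd p - snd q\<bar>)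
    = (LINT x:U|lborel. LINT y:U|lborel. c x y) * (LINT t:{a<..<b}|lborel. LINT s:{a<..<b}|lborel. \<tau> \<bar>t - s\<bar>)
      / (measure lborel U * (b - a))\<^sup>2"
proof -
  let ?I = "{a<..<b}" and ?m = "measure lborel U * (b - a)"
  have finU: "emeasure lborel U < \<infinity>"
    using U measure_zero_top[of lborel U] by (auto simp: less_top[symmetric])
  have B: "0 \<le> B" "0 \<le> B'"
    using c_le[of undefined undefined] \<tau>_le[of 0] by auto
  define cU where "cU x = (LINT y:U|lborel. c x y)" for x
  define \<tau>I where "\<tau>I t = (LINT s:?I|lborel. \<tau> \<bar>t - s\<bar>)" for t
  have [measurable]: "cU \<in> borel_measurable borel"
    unfolding cU_def[abs_def] set_lebesgue_integral_def by measurable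
  have [measurable]: "\<tau>I \<in> borel_measurable borel"
    unfolding \<tau>I_def[abs_def] set_lebesgue_integral_def by measurable
  have c_compose [measurable (raw)]: "(\<lambda>z. c (f z) (g z)) \<in> borel_measurable K"
    if [measurable]: "f \<in> borel_measurable K" "g \<in> borel_measurable K" for f g and K :: "'z measure"
    using measurable_compose[OF measurable_Pair[OF that] c] by simp
  have fst_borel [measurable]: "(fst :: 'a \<times> real \<Rightarrow> 'a) \<in> borel_measurable borel"
    and snd_borel [measurable]: "(snd :: 'a \<times> real \<Rightarrow> real) \<in> borel_measurable borel"
    unfolding borel_prod[symmetric] by measurable
  have cx [measurable]: "c x \<in> borel_measurable borel" for x
    using measurable_Pair2[OF c, of x] by simp
  have cU_le: "\<bar>cU x\<bar> \<le> B * measure lborel U" for x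
    unfolding cU_def by (rule abs_set_integral_le) (use finU c_le in auto)
  have \<tau>I_le: "\<bar>\<tau>I t\<bar> \<le> B' * measure lborel ?I" for t
    unfolding \<tau>I_def by (rule abs_set_integral_le) (use \<tau>_le ab in auto)
  have inner: "(LINT q|N. c (fst p) (fst q) * \<tau> \<bar>snd p - snd q\<bar>) = cU (fst p) * \<tau>I (snd p) / ?m" for p
  proof -
    have "(LINT q|N. c (fst p) (fst q) * \<tau> \<bar>snd p - snd q\<bar>)
        = (LINT s:?I|lborel. LINT y:U|lborel. c (fst p) y * \<tau> \<bar>snd p - s\<bar>) / ?m"
      unfolding N_def
    proof (subst integral_uniform_cylinder[where B="B * B'"])
      show "\<bar>c (fst p) (fst q) * \<tau> \<bar>snd p - snd q\<bar>\<bar> \<le> B * B'" for q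
        unfolding abs_mult using B c_le \<tau>_le by (intro mult_mono) auto
    qed (use U ab in auto)
    also have "(LINT s:?I|lborel. LINT y:U|lborel. c (fst p) y * \<tau> \<bar>snd p - s\<bar>) = cU (fst p) * \<tau>I (snd p)"
      unfolding cU_def \<tau>I_def by simp
    finally show ?thesis .
  qed
  have "(LINT p|N. LINT q|N. c (fst p) (fst q) * \<tau> \<bar>snd p - snd q\<bar>) = (LINT p|N. cU (fst p) * \<tau>I (snd p)) / ?m"
    by (simp add: inner)
  also have "(LINT p|N. cU (fst p) * \<tau>I (snd p)) = (LINT t:?I|lborel. LINT x:U|lborel. cU x * \<tau>I t) / ?m"
    unfolding N_def
  proof (subst integral_uniform_cylinder[where B="(B * measure lborel U) * (B' * measure lborel ?I)"])
    show "\<bar>cU (fst p) * \<tau>I (snd p)\<bar> \<le> (B * measure lborel U) * (B' * measure lborel ?I)" for p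
      unfolding abs_mult using B cU_le \<tau>I_le by (intro mult_mono) auto
  qed (use U ab in auto)
  also have "(LINT t:?I|lborel. LINT x:U|lborel. cU x * \<tau>I t) = (LINT x:U|lborel. cU x) * (LINT t:?I|lborel. \<tau>I t)"
    by simp
  finally show ?thesis
    by (simp add: cU_def \<tau>I_def power2_eq_square)
qed

text \<open>
  Substitute \<open>s = t - v\<close>: the set of all \<open>t\<close> for which both \<open>t\<close> and \<open>t - v\<close> lie in the interval has
  length \<open>max 0 (b - a - \<bar>v\<bar>)\<close>, and the integrand is even in \<open>v\<close>.
\<close>

lemma integral_interval_difference:
  fixes F :: "real \<Rightarrow> real"
  assumes [measurable]: "F \<in> borel_measurable borel" and bound: "\<And>v. \<bar>F v\<bar> \<le> B" and ab: "a < b"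
  shows "(LINT t:{a<..<b}|lborel. LINT s:{a<..<b}|lborel. F \<bar>t - s\<bar>)
    = 2 * (LINT v:{0..b - a}|lborel. F v * (b - a - v))"
proof -
  define r where "r = b - a"
  have r: "r > 0" using ab by (simp add: r_def)
  have B: "0 \<le> B" using bound[of 0] by auto
  let ?I = "indicator {a<..<b} :: real \<Rightarrow> real"
  define h where "h v = F \<bar>v\<bar> * max 0 (r - \<bar>v\<bar>)" for v
  have [measurable]: "h \<in> borel_measurable borel"
    unfolding h_def[abs_def] by measurable
  have h_le: "\<bar>h v\<bar> \<le> (B * r) * indicator {- r..r} v" for v
  proof (cases "\<bar>v\<bar> \<le> r")
    case True
    then have "\<bar>h v\<bar> \<le> B * r"
      unfolding h_def abs_mult using bound r B by (intro mult_mono) auto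
    then show ?thesis using True by (auto simp: indicator_def)
  qed (auto simp: h_def indicator_def)
  have int_h: "integrable lborel h"
    by (rule integrable_bounded_support[OF _ _ _ h_le]) (use r in auto)
  have overlap: "(LINT t|lborel. ?I t * ?I (t - v)) = max 0 (r - \<bar>v\<bar>)" for v
  proof -
    have "(LINT t|lborel. ?I t * ?I (t - v)) = (LINT t|lborel. indicator {max a (a + v)<..<min b (b + v)} t)"
      by (intro Bochner_Integration.integral_cong) (auto simp: indicator_def)
    also have "\<dots> = max 0 (r - \<bar>v\<bar>)"
      using ab by (auto simp: r_def measure_def emeasure_lborel_box_eq max_def min_def)
    finally show ?thesis .
  qed
  have "(LINT t:{a<..<b}|lborel. LINT s:{a<..<b}|lborel. F \<bar>t - s\<bar>)
      = (LINT t|lborel. LINT s|lborel. ?I t * ?I s * F \<bar>t - s\<bar>)"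
    unfolding set_lebesgue_integral_def by (simp add: mult.assoc)
  also have "\<dots> = (LINT t|lborel. LINT v|lborel. ?I t * ?I (t - v) * F \<bar>v\<bar>)"
  proof (rule Bochner_Integration.integral_cong[OF refl])
    fix t
    show "(LINT s|lborel. ?I t * ?I s * F \<bar>t - s\<bar>) = (LINT v|lborel. ?I t * ?I (t - v) * F \<bar>v\<bar>)"
      by (subst lborel_integral_real_affine[where t=t and c="-1"]) auto
  qed
  also have "\<dots> = (LINT v|lborel. LINT t|lborel. ?I t * ?I (t - v) * F \<bar>v\<bar>)"
  proof (rule lborel_pair.Fubini_integral[symmetric])
    show "integrable (lborel \<Otimes>\<^sub>M lborel) (\<lambda>(t, v). ?I t * ?I (t - v) * F \<bar>v\<bar>)"
    proof (rule integrable_bounded_support[where A="{a<..<b} \<times> {- r<..<r}" and B=B])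
      show "emeasure (lborel \<Otimes>\<^sub>M lborel) ({a<..<b} \<times> {- r<..<r}) < \<infinity>"
        using ab r by (subst lborel.emeasure_pair_measure_Times) (auto simp: ennreal_mult[symmetric])
      show "\<bar>case z of (t, v) \<Rightarrow> ?I t * ?I (t - v) * F \<bar>v\<bar>\<bar> \<le> B * indicator ({a<..<b} \<times> {- r<..<r}) z" for z
        using bound B by (cases z) (auto simp: indicator_def r_def)
    qed auto
  qed
  also have "\<dots> = (LINT v|lborel. h v)"
    by (simp add: overlap h_def mult.commute)
  also have "\<dots> = (LINT v|lborel. indicator {0..} v * h v) + (LINT v|lborel. indicator {..<0} v * h v)"
  proof -
    have int: "integrable lborel (\<lambda>v. indicator {0..} v * h v)" "integrable lborel (\<lambda>v. indicator {..<0} v * h v)"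
      using integrable_real_mult_indicator[OF _ int_h, of "{0..}"] integrable_real_mult_indicator[OF _ int_h, of "{..<0}"]
      by (auto simp: mult.commute)
    show ?thesis
      by (subst Bochner_Integration.integral_add[OF int, symmetric])
         (auto intro!: Bochner_Integration.integral_cong simp: indicator_def)
  qed
  also have "(LINT v|lborel. indicator {..<0} v * h v) = (LINT v|lborel. indicator {0<..} v * h v)"
    by (subst lborel_integral_real_affine[where t=0 and c="-1"])
       (auto intro!: Bochner_Integration.integral_cong simp: indicator_def h_def)
  also have "\<dots> = (LINT v|lborel. indicator {0..} v * h v)"
  proof (rule integral_cong_AE)
    show "AE v in lborel. indicator {0<..} v * h v = indicator {0..} v * h v"
      using AE_lborel_singleton[of 0] by eventually_elim (auto simp: indicator_def)
  qed auto
  also have "(LINT v|lborel. indicator {0..} v * h v) = (LINT v:{0..r}|lborel. F v * (r - v))"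
    unfolding set_lebesgue_integral_def
    by (intro Bochner_Integration.integral_cong) (auto simp: indicator_def h_def)
  finally show ?thesis by (simp add: r_def)
qed

section \<open>Negligibility of the squared covariance\<close>

text \<open>
  Where \<open>T\<close> is small, \<open>T\<^sup>2\<close> is a small multiple of \<open>T\<close>; this holds beyond some point \<open>S\<close>, and
  \<open>{0..S}\<close> contributes to \<open>J2 r\<close> an amount that is at most linear in \<open>r\<close>. On the other hand
  \<open>J r \<ge> r / 2 * (LINT v:{0..r / 2}|lborel. T v)\<close>, which is superlinear because the mass of \<open>T\<close> is
  infinite.
\<close>

lemma
  fixes T :: "real \<Rightarrow> real"
  assumes [measurable]: "T \<in> borel_measurable borel"
    and T_nonneg: "\<And>v. 0 \<le> T v" and T_le: "\<And>v. T v \<le> T0"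
    and T_lim: "(T \<longlongrightarrow> 0) at_top"
    and mass: "filterlim (\<lambda>r. LINT v:{0..r}|lborel. T v) at_top at_top"
  defines "J \<equiv> \<lambda>r. LINT v:{0..r}|lborel. T v * (r - v)"
    and "J2 \<equiv> \<lambda>r. LINT v:{0..r}|lborel. (T v)\<^sup>2 * (r - v)"
  shows eventually_weighted_mass_pos: "eventually (\<lambda>r. J r > 0) at_top"
    and weighted_square_negligible: "((\<lambda>r. J2 r / J r) \<longlongrightarrow> 0) at_top"
proof -
  have T0: "0 \<le> T0" using T_nonneg[of 0] T_le[of 0] by simp
  have int: "integrable lborel (\<lambda>v. indicator {0..r} v * G v)"
    if [measurable]: "G \<in> borel_measurable borel" and le: "\<And>v. 0 \<le> v \<Longrightarrow> v \<le> r \<Longrightarrow> \<bar>G v\<bar> \<le> B" for G and r B :: real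
    by (rule integrable_bounded_support[where A="{0..r}" and B=B]) (use le in \<open>auto simp: indicator_def emeasure_lborel_Icc_eq\<close>)
  have int_J: "integrable lborel (\<lambda>v. indicator {0..r} v * (T v * (r - v)))" for r
    by (rule int[of _ _ "T0 * r"]) (use T_nonneg T_le T0 in \<open>auto simp: abs_mult intro!: mult_mono\<close>)
  have int_J2: "integrable lborel (\<lambda>v. indicator {0..r} v * ((T v)\<^sup>2 * (r - v)))" for r
    by (rule int[of _ _ "T0\<^sup>2 * r"])
       (use T_nonneg T_le T0 in \<open>auto simp: abs_mult intro!: mult_mono power_mono\<close>)
  have superlinear: "eventually (\<lambda>r. L * r \<le> J r) at_top" for L
  proof -
    have "filterlim (\<lambda>r. LINT v:{0..r / 2}|lborel. T v) at_top at_top"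
      using filterlim_compose[OF mass filterlim_tendsto_pos_mult_at_top[OF tendsto_const[of "1 / 2"] _ filterlim_ident]]
      by simp
    then have "eventually (\<lambda>r. 2 * L \<le> (LINT v:{0..r / 2}|lborel. T v)) at_top"
      by (simp add: filterlim_at_top)
    then show ?thesis
      using eventually_ge_at_top[of 0]
    proof eventually_elim
      case (elim r)
      \<comment> \<open>On the first half of the interval the weight \<open>r - v\<close> is at least \<open>r / 2\<close>.\<close>
      have "L * r \<le> r / 2 * (LINT v:{0..r / 2}|lborel. T v)"
        using mult_left_mono[OF elim(1), of "r / 2"] elim(2) by (simp add: mult.commute)
      also have "\<dots> = (LINT v|lborel. r / 2 * (indicator {0..r / 2} v * T v))"
        by (simp add: set_lebesgue_integral_def)
      also have "\<dots> \<le> (LINT v|lborel. indicator {0..r} v * (T v * (r - v)))"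
      proof (rule integral_mono[OF _ int_J])
        show "integrable lborel (\<lambda>v. r / 2 * (indicator {0..r / 2} v * T v))"
          using T_nonneg T_le by (intro integrable_mult_right int[of _ _ T0]) auto
        show "r / 2 * (indicator {0..r / 2} v * T v) \<le> indicator {0..r} v * (T v * (r - v))" for v
          using T_nonneg[of v] elim(2) mult_right_mono[of "r / 2" "r - v" "T v"]
          by (auto simp: indicator_def mult_ac)
      qed
      also have "\<dots> = J r"
        by (simp add: J_def set_lebesgue_integral_def)
      finally show ?case .
    qed
  qed
  show pos: "eventually (\<lambda>r. J r > 0) at_top"
    using superlinear[of 1] eventually_gt_at_top[of 0] by eventually_elim simp
  have J2_nonneg: "0 \<le> J2 r" for r
    unfolding J2_def set_lebesgue_integral_def
    by (intro integral_nonneg_AE AE_I2) (auto simp: indicator_def)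
  show "((\<lambda>r. J2 r / J r) \<longlongrightarrow> 0) at_top"
  proof (rule tendstoI)
    fix e :: real assume e: "e > 0"
    have "eventually (\<lambda>v. T v < e / 4) at_top"
      using order_tendstoD(2)[OF T_lim, of "e / 4"] e by simp
    then obtain S where S: "\<And>v. v \<ge> S \<Longrightarrow> T v < e / 4"
      by (auto simp: eventually_at_top_linorder)
    define S' where "S' = max S 0"
    have S': "0 \<le> S'" "\<And>v. v \<ge> S' \<Longrightarrow> T v < e / 4"
      using S by (auto simp: S'_def)
    show "eventually (\<lambda>r. dist (J2 r / J r) 0 < e) at_top"
      using superlinear[of "4 * T0\<^sup>2 * S' / e"] pos eventually_ge_at_top[of 0]
    proof eventually_elim
      case (elim r)
      have "J2 r = (LINT v|lborel. indicator {0..r} v * ((T v)\<^sup>2 * (r - v)))"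
        by (simp add: J2_def set_lebesgue_integral_def)
      also have "\<dots> \<le> (LINT v|lborel. e / 4 * (indicator {0..r} v * (T v * (r - v))) + indicator {0..S'} v * (T0\<^sup>2 * r))"
      proof (rule integral_mono[OF int_J2])
        show "integrable lborel (\<lambda>v. e / 4 * (indicator {0..r} v * (T v * (r - v))) + indicator {0..S'} v * (T0\<^sup>2 * r))"
          by (intro Bochner_Integration.integrable_add integrable_mult_right int_J int[of _ _ "\<bar>T0\<^sup>2 * r\<bar>"]) auto
        show "indicator {0..r} v * ((T v)\<^sup>2 * (r - v))
            \<le> e / 4 * (indicator {0..r} v * (T v * (r - v))) + indicator {0..S'} v * (T0\<^sup>2 * r)" for v
        proof (cases "v \<in> {0..r}")
          case v: True
          have nn: "0 \<le> T v * (r - v)" using T_nonneg v by simp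
          show ?thesis
          proof (cases "v \<le> S'")
            case True
            have "(T v)\<^sup>2 * (r - v) \<le> T0\<^sup>2 * r"
              using v T_nonneg T_le T0 by (intro mult_mono power_mono) auto
            moreover have "0 \<le> e / 4 * (T v * (r - v))"
              using nn e by simp
            ultimately show ?thesis using v True by simp
          next
            case False
            then have "T v * (T v * (r - v)) \<le> e / 4 * (T v * (r - v))"
              using S'(2)[of v] nn by (intro mult_right_mono) auto
            then show ?thesis using v False by (simp add: power2_eq_square mult.assoc)
          qed
        next
          case False
          then show ?thesis using elim(3) by (auto simp: indicator_def)
        qed
      qed
      also have "\<dots> = e / 4 * J r + S' * (T0\<^sup>2 * r)"
      proof -
        have "integrable lborel (\<lambda>v. e / 4 * (indicator {0..r} v * (T v * (r - v))))"
          by (intro integrable_mult_right int_J)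
        moreover have "integrable lborel (\<lambda>v. indicator {0..S'} v * (T0\<^sup>2 * r))"
          by (rule int[of _ _ "\<bar>T0\<^sup>2 * r\<bar>"]) auto
        ultimately show ?thesis
          using S'(1) by (simp add: J_def set_lebesgue_integral_def)
      qed
      also have "\<dots> \<le> e / 4 * J r + e / 4 * J r"
        using elim(1) e by (simp add: field_simps)
      finally have "J2 r \<le> e / 2 * J r" by simp
      then have "J2 r / J r \<le> e / 2"
        using elim(2) by (simp add: divide_le_eq)
      moreover have "0 \<le> J2 r / J r"
        using J2_nonneg[of r] elim(2) by simp
      ultimately show ?case
        using e by (simp only: dist_real_def diff_0_right abs_of_nonneg)
    qed
  qed
qed

section \<open>The limit theorem\<close>

theorem theorem2p10:
  fixes M :: "'w measure"
    and Y X :: "(real ^ 'd) \<times> real \<Rightarrow> 'w \<Rightarrow> real"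
    and C :: "real ^ 'd \<Rightarrow> real ^ 'd \<Rightarrow> real"
    and Ct :: "real \<Rightarrow> real"
    and U :: "nat \<Rightarrow> (real ^ 'd) set"
    and a b :: "nat \<Rightarrow> real"
    and f :: "real \<Rightarrow> real"
    and u \<delta> \<kappa> c\<^sub>1 c\<^sub>2 :: real
  assumes "prob_space M"
    and "gaussian_field M Y"
    and "centered_field M Y"
    and "measurable_field M Y"
    and "gaussian_PA M Y \<or> gaussian_NA M Y"
    and "\<And>x y t s. cov M (Y (x, t)) (Y (y, s)) = C x y * Ct \<bar>t - s\<bar>"
    and "\<And>x t. (LINT \<omega>|M. (Y (x, t) \<omega>)\<^sup>2) = 1"
    and "\<And>r. r \<ge> 0 \<Longrightarrow> Ct r \<ge> 0"
    and "(Ct \<longlongrightarrow> 0) at_top"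
    and "\<And>n. U n \<in> sets borel"
    and "filterlim (\<lambda>n. b n - a n) at_top sequentially"
    and "0 < c\<^sub>1"
    and "\<And>n. c\<^sub>1 \<le> measure lborel (U n) \<and> measure lborel (U n) \<le> c\<^sub>2"
    and "(\<lambda>n. LINT x:U n|lborel. LINT y:U n|lborel. C x y) \<longlonglongrightarrow> \<kappa>"
    and "\<kappa> > 0"
    and "f \<in> borel_measurable borel"
    and "\<And>p \<omega>. X p \<omega> = f (Y p \<omega>)"
    and "inner_phi H\<^sub>1 (\<lambda>y. indicator {u..} (f y)) \<noteq> 0"
    and "0 < \<delta>" and "\<delta> < 1"
    and "filterlim (\<lambda>r. 1 / r powr \<delta> * (LINT v:{0..r}|lborel. Ct v)) at_top at_top"
  shows "weak_conv_m
    (\<lambda>n. distr M borel (\<lambda>\<omega>.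
       ((LINT t:{a n<..<b n}|lborel. LINT x:U n|lborel. indicator {u..} (X (x, t) \<omega>))
          - measure lborel (U n) * (b n - a n) * measure M {\<omega>' \<in> space M. X 0 \<omega>' \<ge> u})
       / (inner_phi H\<^sub>1 (\<lambda>y. indicator {u..} (f y))
          * sqrt (2 * \<kappa> * (LINT s:{0..b n - a n}|lborel. Ct s * (b n - a n - s))))))
    std_normal_distribution"
proof -
  note [measurable] = assms(10) assms(16)
  interpret F: standard_gaussian_field M Y
    by (intro standard_gaussian_field.intro standard_gaussian_field_axioms.intro assms(1-4)) (simp add: assms(7) split_paired_all)
  \<comment> \<open>The temporal covariance matters at nonnegative lags only; its even extension is a Borel
      function on the whole line.\<close>
  define T where "T v = Ct \<bar>v\<bar>" for v
  define T0 where "T0 = Ct 0"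
  define r where "r n = b n - a n" for n
  define g :: "real \<Rightarrow> real" where "g y = indicator {u..} (f y)" for y
  define c0 where "c0 = (LINT x|std_normal_distribution. g x)"
  define c1 where "c1 = (LINT x|std_normal_distribution. x * g x)"
  define A where "A = (LINT x|std_normal_distribution. (g x - c0 - c1 * x)\<^sup>2)"
  define J where "J z = (LINT v:{0..z}|lborel. T v * (z - v))" for z
  define J2 where "J2 z = (LINT v:{0..z}|lborel. (T v)\<^sup>2 * (z - v))" for z
  define \<kappa>n where "\<kappa>n n = (LINT x:U n|lborel. LINT y:U n|lborel. C x y)" for n
  define Q where "Q n = (LINT x:U n|lborel. LINT y:U n|lborel. (C x y)\<^sup>2)" for n

  have g_measurable [measurable]: "g \<in> borel_measurable borel"
    unfolding g_def[abs_def] using assms(16) by measurable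
  have g_le: "\<bar>g x\<bar> \<le> 1" for x by (simp add: g_def indicator_def)

  have corr: "F.correlation p q = C (fst p) (fst q) * T \<bar>snd p - snd q\<bar>" for p q
    using assms(6)[of "fst p" "snd p" "fst q" "snd q"] by (simp add: cov_def F.mean_value T_def)
  have diag: "C x x * T0 = 1" for x
    using corr[of "(x, 0)" "(x, 0)"] F.unit_variance[of "(x, 0)"] by (simp add: power2_eq_square T_def T0_def)
  have T0: "T0 > 0"
    using diag[of 0] assms(8)[of 0] by (cases "Ct 0 = 0") (auto simp: T0_def)
  have T_nonneg: "0 \<le> T v" for v by (simp add: T_def assms(8))
  \<comment> \<open>Both factors are bounded because correlations are, and because \<open>C x x = 1 / T0\<close>.\<close>
  have T_le: "T v \<le> T0" for v
  proof -
    have "\<bar>C 0 0 * T v\<bar> \<le> 1"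
      using F.abs_correlation_le[of "(0, v)" "(0, 0)"] unfolding corr by (simp add: T_def)
    moreover have "C 0 0 = 1 / T0" using diag[of 0] T0 by (simp add: field_simps)
    ultimately show ?thesis using T0 T_nonneg[of v] by (simp add: field_simps)
  qed
  have C_le: "\<bar>C x y\<bar> \<le> 1 / T0" for x y
    using F.abs_correlation_le[of "(x, 0)" "(y, 0)"] T0 unfolding corr
    by (simp add: T_def T0_def abs_mult field_simps)
  \<comment> \<open>Up to constants, both factors of the covariance are covariances of values of the field, hence measurable.\<close>
  have C_eq: "C x y = F.correlation (x, 0) (y, 0) / T0" for x y
    unfolding corr using T0 by (simp add: T_def T0_def)
  have C_measurable [measurable]: "(\<lambda>(x, y). C x y) \<in> borel_measurable (borel \<Otimes>\<^sub>M borel)"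
    unfolding C_eq by measurable
  have T_eq: "T v = F.correlation (0, v) (0, 0) / C 0 0" for v
    unfolding corr using diag[of 0] by (auto simp: T_def)
  have T_measurable [measurable]: "T \<in> borel_measurable borel"
    unfolding T_eq[abs_def] by measurable

  have T_lim: "(T \<longlongrightarrow> 0) at_top"
    by (rule Lim_transform_eventually[OF assms(9)])
       (use eventually_ge_at_top[of 0] in eventually_elim, simp add: T_def)
  have J_eq: "J z = (LINT s:{0..z}|lborel. Ct s * (z - s))" for z
    unfolding J_def by (rule set_lebesgue_integral_cong) (auto simp: T_def)
  have mass: "filterlim (\<lambda>z. LINT v:{0..z}|lborel. T v) at_top at_top"
  proof (rule filterlim_at_top_mono[OF assms(21)])
    show "\<forall>\<^sub>F z in at_top. 1 / z powr \<delta> * (LINT v:{0..z}|lborel. Ct v) \<le> (LINT v:{0..z}|lborel. T v)"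
      using eventually_ge_at_top[of 1]
    proof eventually_elim
      case (elim z)
      have eq: "(LINT v:{0..z}|lborel. Ct v) = (LINT v:{0..z}|lborel. T v)"
        by (rule set_lebesgue_integral_cong) (auto simp: T_def)
      have "0 \<le> (LINT v:{0..z}|lborel. T v)"
        unfolding set_lebesgue_integral_def using T_nonneg by (intro integral_nonneg_AE AE_I2) simp
      moreover have "1 / z powr \<delta> \<le> 1"
        using elim \<open>0 < \<delta>\<close> by (simp add: ge_one_powr_ge_zero)
      ultimately show ?case
        unfolding eq
        using mult_right_mono[of "1 / z powr \<delta>" 1 "LINT v:{0..z}|lborel. T v"] by simp
    qed
  qed
  have r_lim: "filterlim r at_top sequentially"
    using assms(11) by (simp add: r_def[abs_def])
  have J_pos: "eventually (\<lambda>n. J (r n) > 0) sequentially"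
    using eventually_compose_filterlim[OF eventually_weighted_mass_pos[OF T_measurable T_nonneg T_le T_lim mass] r_lim]
    by (simp add: J_def)
  have ratio: "(\<lambda>n. J2 (r n) / J (r n)) \<longlonglongrightarrow> 0"
    using filterlim_compose[OF weighted_square_negligible[OF T_measurable T_nonneg T_le T_lim mass] r_lim]
    by (simp add: J_def J2_def)

  have c1: "inner_phi H\<^sub>1 (\<lambda>y. indicator {u..} (f y)) = c1"
    unfolding inner_phi_def H\<^sub>1_def c1_def g_def[symmetric]
    by (subst integral_density) (auto simp: mult_ac)
  have "c1 \<noteq> 0" using assms(18) by (simp add: c1)
  have c0: "measure M {\<omega>' \<in> space M. X 0 \<omega>' \<ge> u} = c0"
  proof -
    have "c0 = (LINT x|distr M borel (Y 0). g x)"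
      by (simp add: c0_def F.distr_value)
    also have "\<dots> = (LINT \<omega>|M. indicator {u..} (f (Y 0 \<omega>)))"
      by (subst integral_distr) (auto simp: g_def)
    also have "\<dots> = measure M {\<omega>' \<in> space M. X 0 \<omega>' \<ge> u}"
      by (subst integral_indicator_comp) (auto intro!: arg_cong[of _ _ "measure M"] simp: assms(17))
    finally show ?thesis ..
  qed
  have U_pos: "0 < measure lborel (U n)" for n
    using assms(12) assms(13)[of n] by linarith
  have U_fin: "emeasure lborel (U n) < \<infinity>" for n
    using U_pos[of n] measure_zero_top[of lborel "U n"] by (auto simp: less_top[symmetric])
  have C_section [measurable]: "C x \<in> borel_measurable borel" for x
    using measurable_Pair2[OF C_measurable, of x] by simp
  have Q_le: "Q n \<le> (c\<^sub>2 / T0)\<^sup>2" for n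
  proof -
    define B where "B = (1 / T0)\<^sup>2"
    have C2: "\<bar>(C x y)\<^sup>2\<bar> \<le> B" for x y
      using C_le[of x y] T0 unfolding B_def by (simp add: abs_le_square_iff[symmetric])
    have inner: "\<bar>LINT y:U n|lborel. (C x y)\<^sup>2\<bar> \<le> B * measure lborel (U n)" for x
      by (rule abs_set_integral_le[OF _ _ U_fin C2]) auto
    have [measurable (raw)]: "(\<lambda>z. C (f z) (g z)) \<in> borel_measurable K"
      if [measurable]: "f \<in> borel_measurable K" "g \<in> borel_measurable K" for f g and K :: "'z measure"
      using measurable_compose[OF measurable_Pair[OF that] C_measurable] by simp
    have [measurable]: "(\<lambda>x. LINT y:U n|lborel. (C x y)\<^sup>2) \<in> borel_measurable borel"
      unfolding set_lebesgue_integral_def by measurable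
    have "\<bar>Q n\<bar> \<le> (B * measure lborel (U n)) * measure lborel (U n)"
      unfolding Q_def by (rule abs_set_integral_le[OF _ _ U_fin inner]) auto
    also have "\<dots> \<le> (B * c\<^sub>2) * c\<^sub>2"
      using assms(13)[of n] U_pos[of n] by (intro mult_mono) (auto simp: B_def)
    finally show ?thesis by (simp add: B_def power2_eq_square)
  qed

  define V where "V n \<omega> = ((LINT t:{a n<..<b n}|lborel. LINT x:U n|lborel. indicator {u..} (X (x, t) \<omega>))
          - measure lborel (U n) * (b n - a n) * measure M {\<omega>' \<in> space M. X 0 \<omega>' \<ge> u})
       / (inner_phi H\<^sub>1 (\<lambda>y. indicator {u..} (f y))
          * sqrt (2 * \<kappa> * (LINT s:{0..b n - a n}|lborel. Ct s * (b n - a n - s))))" for n \<omega>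
  have V_measurable [measurable]: "V n \<in> borel_measurable M" for n
    unfolding V_def[abs_def] assms(17) set_lebesgue_integral_def by measurable
  \<comment> \<open>Both second moments carry a factor \<open>1 / m\<^sup>2\<close>, where \<open>m\<close> is the volume of the cylinder. It cancels
      against \<open>w\<^sup>2\<close>: what remains is \<open>\<kappa>n / \<kappa>\<close> for the Gaussian part, and a constant times \<open>J2 / J\<close> for
      the error.\<close>
  have estimate: "cmod (char (distr M borel (V n)) s - exp (- (s\<^sup>2 * (\<kappa>n n / \<kappa>)) / 2))
      \<le> \<bar>s\<bar> * sqrt (2 * A * (c\<^sub>2 / T0)\<^sup>2 / (c1\<^sup>2 * \<kappa>) * (J2 (r n) / J (r n)))"
    if r: "r n > 0" and J: "J (r n) > 0" for n s
  proof -
    have ab: "a n < b n" using r by (simp add: r_def)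
    define m where "m = measure lborel (U n) * r n"
    have m: "m > 0" using U_pos r by (simp add: m_def)
    define N where "N = uniform_measure lborel (U n \<times> {a n<..<b n})"
    interpret N: prob_space N
      unfolding N_def using U_pos ab by (intro prob_space_uniform_cylinder) auto
    interpret NF: averaged_gaussian_field M Y N
      by unfold_locales (simp add: N_def)
    define w where "w = m / (c1 * sqrt (2 * \<kappa> * J (r n)))"
    have V: "V n \<omega> = w * ((LINT p|N. g (Y p \<omega>)) - c0)" if \<omega>: "\<omega> \<in> space M" for \<omega>
    proof -
      have "(LINT p|N. g (Y p \<omega>)) = (LINT t:{a n<..<b n}|lborel. LINT x:U n|lborel. g (Y (x, t) \<omega>)) / m"
        unfolding N_def m_def r_def using ab U_pos \<omega> g_le
        by (intro integral_uniform_cylinder[where B=1]) auto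
      then have "(LINT t:{a n<..<b n}|lborel. LINT x:U n|lborel. g (Y (x, t) \<omega>)) = m * (LINT p|N. g (Y p \<omega>))"
        using m by simp
      then show ?thesis
        unfolding V_def
        unfolding c0 c1 w_def J_eq r_def[symmetric]
        unfolding assms(17) g_def[symmetric] m_def[symmetric]
        by (simp add: right_diff_distrib diff_divide_distrib)
    qed
    have s1: "(LINT p|N. LINT q|N. F.correlation p q) = \<kappa>n n * (2 * J (r n)) / m\<^sup>2"
      unfolding corr N_def
      by (subst double_average_cylinder[where B="1 / T0" and B'=T0])
         (use U_pos ab C_le T_nonneg T_le in \<open>auto simp: integral_interval_difference[where B=T0] \<kappa>n_def J_def m_def r_def\<close>)
    have s2: "(LINT p|N. LINT q|N. (F.correlation p q)\<^sup>2) = Q n * (2 * J2 (r n)) / m\<^sup>2"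
    proof -
      have C2: "\<bar>(C x y)\<^sup>2\<bar> \<le> (1 / T0)\<^sup>2" for x y
        using C_le[of x y] T0 by (simp add: abs_le_square_iff[symmetric])
      have T2: "\<bar>(T v)\<^sup>2\<bar> \<le> T0\<^sup>2" for v
        using T_nonneg T_le by (simp add: power_mono)
      have C2_measurable: "(\<lambda>(x, y). (C x y)\<^sup>2) \<in> borel_measurable (borel \<Otimes>\<^sub>M borel)"
        using C_measurable by (auto simp: case_prod_beta')
      have "(LINT p|N. LINT q|N. (C (fst p) (fst q))\<^sup>2 * (T \<bar>snd p - snd q\<bar>)\<^sup>2)
          = Q n * (LINT t:{a n<..<b n}|lborel. LINT s:{a n<..<b n}|lborel. (T \<bar>t - s\<bar>)\<^sup>2) / m\<^sup>2"
        unfolding N_def Q_def m_def r_def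
        by (rule double_average_cylinder[OF _ _ C2_measurable U_pos ab C2 T2]) auto
      also have "(LINT t:{a n<..<b n}|lborel. LINT s:{a n<..<b n}|lborel. (T \<bar>t - s\<bar>)\<^sup>2) = 2 * J2 (r n)"
        unfolding J2_def r_def by (rule integral_interval_difference[OF _ T2 ab]) auto
      finally show ?thesis
        unfolding corr power_mult_distrib .
    qed
    have s2\<kappa>: "(sqrt (2 * \<kappa> * J (r n)))\<^sup>2 = 2 * \<kappa> * J (r n)"
      using J \<open>\<kappa> > 0\<close> by simp
    have w1: "(w * c1)\<^sup>2 = m\<^sup>2 / (2 * \<kappa> * J (r n))"
      unfolding w_def using \<open>c1 \<noteq> 0\<close> by (simp add: power_divide power_mult_distrib s2\<kappa>)
    have w2: "w\<^sup>2 = m\<^sup>2 / (c1\<^sup>2 * (2 * \<kappa> * J (r n)))"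
      unfolding w_def power_divide power_mult_distrib s2\<kappa> ..
    have v1: "(w * c1)\<^sup>2 * (LINT p|N. LINT q|N. F.correlation p q) = \<kappa>n n / \<kappa>"
      unfolding w1 s1 using m J by simp
    have v2: "w\<^sup>2 * (2 * A * (LINT p|N. LINT q|N. (F.correlation p q)\<^sup>2))
        = 2 * A * Q n / (c1\<^sup>2 * \<kappa>) * (J2 (r n) / J (r n))"
      unfolding w2 s2 using m J by (simp add: mult_ac)
    have A: "0 \<le> A" by (simp add: A_def)
    have J2: "0 \<le> J2 (r n)"
      unfolding J2_def set_lebesgue_integral_def
      by (intro integral_nonneg_AE AE_I2) (auto simp: indicator_def)
    have "distr M borel (V n) = distr M borel (\<lambda>\<omega>. w * ((LINT p|N. g (Y p \<omega>)) - c0))"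
      by (rule distr_cong) (auto simp: V)
    then have "cmod (char (distr M borel (V n)) s - exp (- (s\<^sup>2 * (\<kappa>n n / \<kappa>)) / 2))
        \<le> \<bar>s\<bar> * sqrt (2 * A * Q n / (c1\<^sup>2 * \<kappa>) * (J2 (r n) / J (r n)))"
      using NF.char_subordinated_average[OF g_measurable g_le, of w s]
      unfolding c0_def[symmetric] c1_def[symmetric] A_def[symmetric] v1 v2 by simp
    also have "\<dots> \<le> \<bar>s\<bar> * sqrt (2 * A * (c\<^sub>2 / T0)\<^sup>2 / (c1\<^sup>2 * \<kappa>) * (J2 (r n) / J (r n)))"
      using Q_le[of n] A J2 J \<open>\<kappa> > 0\<close>
      by (intro mult_left_mono real_sqrt_le_mono mult_right_mono divide_right_mono) auto
    finally show ?thesis .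
  qed
  have "weak_conv_m (\<lambda>n. distr M borel (V n)) std_normal_distribution"
  proof (rule levy_continuity)
    show "real_distribution (distr M borel (V n))" for n
      by (rule F.real_distribution_distr) simp
    show "real_distribution std_normal_distribution"
      by (rule real_dist_normal_dist)
    fix s
    \<comment> \<open>The spatial factor \<open>\<kappa>n\<close> has limit \<open>\<kappa>\<close>, so the Gaussian part has variance tending to \<open>1\<close>.\<close>
    have main: "(\<lambda>n. complex_of_real (exp (- (s\<^sup>2 * (\<kappa>n n / \<kappa>)) / 2))) \<longlonglongrightarrow> complex_of_real (exp (- (s\<^sup>2 * (\<kappa> / \<kappa>)) / 2))"
      using assms(14) \<open>\<kappa> > 0\<close> unfolding \<kappa>n_def[abs_def, symmetric] by (intro tendsto_intros) auto
    have error: "(\<lambda>n. char (distr M borel (V n)) s - complex_of_real (exp (- (s\<^sup>2 * (\<kappa>n n / \<kappa>)) / 2))) \<longlonglongrightarrow> 0"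
    proof (rule Lim_null_comparison)
      show "\<forall>\<^sub>F n in sequentially. cmod (char (distr M borel (V n)) s - complex_of_real (exp (- (s\<^sup>2 * (\<kappa>n n / \<kappa>)) / 2)))
          \<le> \<bar>s\<bar> * sqrt (2 * A * (c\<^sub>2 / T0)\<^sup>2 / (c1\<^sup>2 * \<kappa>) * (J2 (r n) / J (r n)))"
        using J_pos filterlim_at_top_dense[THEN iffD1, OF r_lim, rule_format, of 0]
        by eventually_elim (rule estimate)
      have "(\<lambda>n. \<bar>s\<bar> * sqrt (2 * A * (c\<^sub>2 / T0)\<^sup>2 / (c1\<^sup>2 * \<kappa>) * (J2 (r n) / J (r n))))
          \<longlonglongrightarrow> \<bar>s\<bar> * sqrt (2 * A * (c\<^sub>2 / T0)\<^sup>2 / (c1\<^sup>2 * \<kappa>) * 0)"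
        by (intro tendsto_intros ratio)
      then show "(\<lambda>n. \<bar>s\<bar> * sqrt (2 * A * (c\<^sub>2 / T0)\<^sup>2 / (c1\<^sup>2 * \<kappa>) * (J2 (r n) / J (r n)))) \<longlonglongrightarrow> 0"
        by simp
    qed
    show "(\<lambda>n. char (distr M borel (V n)) s) \<longlonglongrightarrow> char std_normal_distribution s"
      using tendsto_add[OF error main] \<open>\<kappa> > 0\<close> by (simp add: char_std_normal_distribution)
  qed
  then show ?thesis
    unfolding V_def[abs_def] .
qed

end
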